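(* Let $\varepsilon > 0$ be fixed. For all real $x \geq 1$ and all integers $q \geq 1$ with $x^{1/2} \leq q \leq x$, we have $$\frac{1}{\varphi(q)} \# \left\{ a \in (\mathbb{Z}/q\mathbb{Z})^{\times} : |E(x;q,a)| > \left( \frac{x}{q} \right)^{1/4} x^{\varepsilon} \right\} \ll x^{-\varepsilon}.$$
   Context: For real $x \geq 1$, an integer $q \geq 1$ with $q \leq x$, and $a \in (\mathbb{Z}/q\mathbb{Z})^{\times}$, let $$S(x;q,a) = \sum_{\substack{1 \leq n \leq x \\ n \equiv a \ (\mathrm{mod}\ q)}} |\mu(n)|,$$ where $\mu$ is the Möbius function, and define $E(x;q,a)$ by $$S(x;q,a) = c_q \frac{x}{q} + E(x;q,a), \qquad c_q = \prod_{p \nmid q} \left( 1 - \frac{1}{p^2} \right),$$ the product being over primes $p$ not dividing $q$. $\varphi$ is Euler's totient function. The notation $A \ll B$ means that $|A| \leq C B$ for some constant $C > 0$ depending only on $\varepsilon$ (in particular, independent of $x$ and $q$). *)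

theory Defs
  imports "HOL-Analysis.Analysis" "HOL-Computational_Algebra.Squarefree" "HOL-Number_Theory.Number_Theory"
begin

definition moebius_mu :: "nat \<Rightarrow> int" where
  "moebius_mu n = (if squarefree n then (-1) ^ card (prime_factors n) else 0)"

definition sqfree_sum :: "real \<Rightarrow> nat \<Rightarrow> nat \<Rightarrow> real" where
  "sqfree_sum x q a =
     (\<Sum>n | 1 \<le> n \<and> real n \<le> x \<and> [n = a] (mod q). real_of_int \<bar>moebius_mu n\<bar>)"

(* Every factor is nonzero, so prodinf is the ordinary limit of the partial products. *)
definition sqfree_const :: "nat \<Rightarrow> real" where
  "sqfree_const q = (\<Prod>p. if prime p \<and> \<not> p dvd q then 1 - 1 / (real p)\<^sup>2 else 1)"

definition sqfree_error :: "real \<Rightarrow> nat \<Rightarrow> nat \<Rightarrow> real" where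
  "sqfree_error x q a = sqfree_sum x q a - sqfree_const q * (x / real q)"

end

theory Submission
  imports Defs
begin

text \<open>
Put \<open>y = sqrt (x / q)\<close>, so that \<open>y\<^sup>2 \<le> q\<close>, and write the squarefree indicator as a sum of
\<open>\<mu> d\<close> over \<open>d\<^sup>2 dvd n\<close>. The part with \<open>d > D = y powr (3/2) * x powr \<eta>\<close> is small on average over
the residues and is discarded by Markov's inequality. The part with \<open>d \<le> D\<close> is treated by
Chebyshev's inequality: its variance is at most the sum over pairs \<open>(a, b)\<close> of the absolute covariances
of the counts of multiples of \<open>a\<^sup>2\<close> and \<open>b\<^sup>2\<close>. If \<open>gcd a b > y\<close>, the counts are 0 or 1 and the
trivial bound \<open>x / (a * b)\<close> suffices. If \<open>gcd a b \<le> y\<close>, Fourier analysis modulo \<open>q\<close> bounds the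
covariance by a quantity depending only on \<open>t = a / b\<close> modulo \<open>q\<close>. Each \<open>t\<close> arises from few
pairs, since primitive points of the lattice \<open>a = t * b\<close> have slopes that are well separated, and
averaging over \<open>t\<close> costs only a divisor function, since a congruence \<open>h * t\<^sup>2 = k\<close> has few solutions.
\<close>

section \<open>The Moebius function\<close>

text \<open>The exponent 3/2 in \<open>D\<close> is fixed from two sides. The discarded part has
  mean about \<open>y\<^sup>2 / D\<close>, which must stay below the threshold
  \<open>y powr (1/2) * x powr \<epsilon>\<close>, so \<open>D\<close> has to reach about
  \<open>y powr (3/2)\<close>. The variance per residue is about \<open>y + D\<^sup>2 / q\<close> up
  to small powers of \<open>x\<close>, and must not exceed the square of the threshold, which is
  about \<open>y\<close>; with \<open>D\<^sup>2\<close> near \<open>y ^ 3\<close> this follows from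
  \<open>y\<^sup>2 \<le> q\<close>. The split by gcd answers a weakness of the Fourier bound: it
  ignores the lengths of the counts and sees only \<open>a / b\<close> modulo \<open>q\<close>, so
  all multiples of one pair cost the same. The diagonal \<open>a = b\<close> alone would put about
  \<open>D\<close> pairs on \<open>t = 1\<close>, where only about \<open>y\<close> are affordable.
  Capping the gcd at \<open>y\<close> leaves about \<open>y + D\<^sup>2 / q\<close> pairs for each
  \<open>t\<close>. All averages run over the \<open>q\<close> residues, not only the reduced ones,
  which makes means and orthogonality exact. The loss \<open>q / totient q\<close> is at most a
  divisor function, paid from a spare power of \<open>x\<close>.\<close>

lemma prime_factors_prod_primes:
  fixes A :: "nat set"
  assumes "finite A" "\<And>p. p \<in> A \<Longrightarrow> prime p"
  shows "prime_factors (\<Prod>A) = A"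
proof -
  have "0 \<notin> A" using assms(2) by fastforce
  hence "prime_factors (\<Prod>A) = (\<Union>a\<in>A. prime_factors a)"
    using prime_factors_prod[of A "\<lambda>x. x"] assms(1) by simp
  also have "\<dots> = A" using assms(2) by (auto simp: prime_factorization_prime)
  finally show ?thesis .
qed

lemma prod_prime_factors_squarefree:
  fixes d :: nat
  assumes d: "squarefree d"
  shows "\<Prod>(prime_factors d) = d"
proof -
  have d0: "d \<noteq> 0" using d by (rule contrapos_pn) simp
  have "d = (\<Prod>p\<in>prime_factors d. p ^ multiplicity p d)"
    using d0 prime_factorization_nat by auto
  also have "\<dots> = (\<Prod>p\<in>prime_factors d. p)"
  proof (rule prod.cong[OF refl])
    fix p assume p: "p \<in> prime_factors d"
    have "multiplicity p d \<le> 1" "multiplicity p d > 0"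
      using d d0 p squarefree_factorial_semiring''[of d] by (auto simp: prime_factors_multiplicity)
    hence "multiplicity p d = 1" by linarith
    thus "p ^ multiplicity p d = p" by simp
  qed
  finally show ?thesis by simp
qed

text \<open>Carries sums over squarefree integers to sums over subsets of \<open>P\<close>, where a
  product of differences can be multiplied out.\<close>

lemma bij_betw_prod_squarefree:
  fixes P :: "nat set"
  assumes fin: "finite P" and prime: "\<And>p. p \<in> P \<Longrightarrow> prime p"
  shows "bij_betw (\<lambda>A. \<Prod>A) (Pow P) {d. squarefree d \<and> prime_factors d \<subseteq> P}"
proof (rule bij_betw_byWitness[where f' = prime_factors])
  have pf: "prime_factors (\<Prod>A) = A" if "A \<subseteq> P" for A
    using that fin prime by (intro prime_factors_prod_primes) (auto intro: finite_subset)
  show "\<forall>A\<in>Pow P. prime_factors (\<Prod>A) = A" using pf by auto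
  show "\<forall>d\<in>{d. squarefree d \<and> prime_factors d \<subseteq> P}. \<Prod>(prime_factors d) = d"
    using prod_prime_factors_squarefree by blast
  show "(\<lambda>A. \<Prod>A) ` Pow P \<subseteq> {d. squarefree d \<and> prime_factors d \<subseteq> P}"
  proof clarify
    fix A assume A: "A \<subseteq> P"
    have "squarefree (\<Prod>A)"
      using A prime by (intro squarefree_prod_coprime primes_coprime squarefree_prime) auto
    thus "squarefree (\<Prod>A) \<and> prime_factors (\<Prod>A) \<subseteq> P" using pf[OF A] A by auto
  qed
  show "prime_factors ` {d. squarefree d \<and> prime_factors d \<subseteq> P} \<subseteq> Pow P" by auto
qed

text \<open>Multiplying out the right side over subsets of \<open>P\<close> gives the left side. The
  constant \<open>f = 1\<close> yields the squarefree indicator, \<open>f p = 1 / p\<^sup>2\<close>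
  the Euler product.\<close>

lemma sum_moebius_mu_mult:
  fixes P :: "nat set" and f :: "nat \<Rightarrow> real"
  assumes fin: "finite P" and prime: "\<And>p. p \<in> P \<Longrightarrow> prime p"
  shows "(\<Sum>d | squarefree d \<and> prime_factors d \<subseteq> P. real_of_int (moebius_mu d) * (\<Prod>p\<in>prime_factors d. f p))
           = (\<Prod>p\<in>P. 1 - f p)"
proof -
  note bij = bij_betw_prod_squarefree[OF fin prime]
  have pf: "prime_factors (\<Prod>A) = A" if "A \<subseteq> P" for A
    using that fin prime by (intro prime_factors_prod_primes) (auto intro: finite_subset)
  have "(\<Sum>d | squarefree d \<and> prime_factors d \<subseteq> P. real_of_int (moebius_mu d) * (\<Prod>p\<in>prime_factors d. f p))
     = (\<Sum>A\<in>Pow P. real_of_int (moebius_mu (\<Prod>A)) * (\<Prod>p\<in>prime_factors (\<Prod>A). f p))"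
    using sum.reindex_bij_betw[OF bij, symmetric] .
  also have "\<dots> = (\<Sum>A\<in>Pow P. (-1) ^ card A * prod f A * (\<Prod>p\<in>P - A. 1))"
  proof (rule sum.cong[OF refl])
    fix A assume "A \<in> Pow P"
    hence A: "A \<subseteq> P" by auto
    have "\<Prod>A \<in> {d. squarefree d \<and> prime_factors d \<subseteq> P}"
      using bij A unfolding bij_betw_def by blast
    thus "real_of_int (moebius_mu (\<Prod>A)) * (\<Prod>p\<in>prime_factors (\<Prod>A). f p)
          = (-1) ^ card A * prod f A * (\<Prod>p\<in>P - A. 1)"
      using pf[OF A] by (simp add: moebius_mu_def)
  qed
  also have "\<dots> = (\<Prod>p\<in>P. 1 - f p)"
    using prod_diff_conv_sum[OF fin, of "\<lambda>_. 1" f] by simp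
  finally show ?thesis .
qed

lemma abs_moebius_mu_le: "\<bar>real_of_int (moebius_mu n)\<bar> \<le> 1"
  by (simp add: moebius_mu_def power_abs)

text \<open>With \<open>s = square_part n\<close>, the \<open>d\<close> whose square divides
  \<open>n\<close> are the divisors of \<open>s\<close>. The Moebius function summed over these
  vanishes unless \<open>s = 1\<close>, that is, unless \<open>n\<close> is squarefree.\<close>

lemma abs_moebius_mu_eq_sum:
  fixes n :: nat
  assumes n: "n > 0"
  shows "real_of_int \<bar>moebius_mu n\<bar> = (\<Sum>d | d\<^sup>2 dvd n. real_of_int (moebius_mu d))"
proof -
  define s where "s = square_part n"
  have s0: "s \<noteq> 0" using n by (simp add: s_def)
  have dv: "d\<^sup>2 dvd n \<longleftrightarrow> d dvd s" for d using dvd_square_part_iff s_def by metis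
  define P where "P = prime_factors s"
  have finP: "finite P" and primeP: "\<And>p. p \<in> P \<Longrightarrow> prime p" unfolding P_def by auto
  have sub: "{d. squarefree d \<and> prime_factors d \<subseteq> P} = {d. squarefree d \<and> d dvd s}"
  proof safe
    fix d :: nat assume d: "squarefree d" "prime_factors d \<subseteq> P"
    have d0: "d \<noteq> 0" using d(1) by (rule contrapos_pn) simp
    show "d dvd s"
    proof (rule multiplicity_le_imp_dvd[OF d0])
      fix p :: nat assume p: "prime p"
      show "multiplicity p d \<le> multiplicity p s"
      proof (cases "p \<in> prime_factors d")
        case True
        have "multiplicity p d \<le> 1"
          using d d0 p by (simp add: squarefree_factorial_semiring'')
        moreover have "multiplicity p s > 0" using True d(2) s0 unfolding P_def
          by (auto simp: prime_factors_multiplicity)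
        ultimately show ?thesis by linarith
      next
        case False
        thus ?thesis using p by (auto simp: prime_factors_multiplicity)
      qed
    qed
  next
    fix d p assume "squarefree d" "d dvd s" "p \<in> prime_factors d"
    thus "p \<in> P" unfolding P_def using s0 by (meson dvd_prime_factors subsetD)
  qed
  have fin: "finite {d. d dvd s}" using s0 by simp
  have "(\<Sum>d | d\<^sup>2 dvd n. real_of_int (moebius_mu d)) = (\<Sum>d | d dvd s. real_of_int (moebius_mu d))"
    by (simp add: dv)
  also have "\<dots> = (\<Sum>d | squarefree d \<and> d dvd s. real_of_int (moebius_mu d))"
    by (rule sum.mono_neutral_right[OF fin]) (auto simp: moebius_mu_def)
  also have "\<dots> = (\<Prod>p\<in>P. 1 - 1)"
    using sum_moebius_mu_mult[OF finP primeP, of "\<lambda>_. 1"] by (simp add: sub)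
  also have "\<dots> = (if P = {} then 1 else 0)" by (simp add: P_def power_0_left card_eq_0_iff)
  also have "P = {} \<longleftrightarrow> s = 1"
    unfolding P_def using s0 by (simp add: prime_factorization_empty_iff)
  also have "s = 1 \<longleftrightarrow> squarefree n"
  proof
    assume "s = 1" thus "squarefree n" by (intro squarefreeI) (simp add: dv)
  next
    assume "squarefree n"
    thus "s = 1" using dv[of s] squarefreeD[of n s] by simp
  qed
  finally show ?thesis by (simp add: moebius_mu_def power_abs)
qed

section \<open>Truncating the Euler product\<close>

text \<open>Telescoping with \<open>1 / (m + 1)\<^sup>2 \<le> 1 / m - 1 / (m + 1)\<close>. An
  arbitrary finite set beyond \<open>D\<close> is allowed because the sets met later are not
  intervals: integers with prescribed prime factors, or coprime to \<open>q\<close>.\<close>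

lemma sum_inverse_squares_le:
  assumes "1 \<le> D" "finite A" "\<And>d. d \<in> A \<Longrightarrow> d > D"
  shows "(\<Sum>d\<in>A. 1 / (real d)\<^sup>2) \<le> 1 / real D"
proof -
  have *: "(\<Sum>d\<in>{D<..D+k}. 1 / (real d)\<^sup>2) \<le> 1 / real D - 1 / real (D + k)" for k
  proof (induction k)
    case (Suc k)
    have "{D<..D + Suc k} = insert (D + Suc k) {D<..D+k}" by auto
    hence "(\<Sum>d\<in>{D<..D + Suc k}. 1 / (real d)\<^sup>2) = 1 / (real (D + Suc k))\<^sup>2 + (\<Sum>d\<in>{D<..D+k}. 1 / (real d)\<^sup>2)"
      by simp
    also have "1 / (real (D + Suc k))\<^sup>2 \<le> 1 / real (D + k) - 1 / real (D + Suc k)"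
    proof -
      have "1 / real (D + k) - 1 / real (D + Suc k) = 1 / (real (D + k) * real (D + Suc k))"
        using assms(1) by (simp add: field_simps)
      moreover have "real (D + k) * real (D + Suc k) \<le> (real (D + Suc k))\<^sup>2"
        unfolding power2_eq_square by (intro mult_right_mono) auto
      moreover have "real (D + k) * real (D + Suc k) > 0" using assms(1) by (intro mult_pos_pos) auto
      ultimately show ?thesis by (simp add: frac_le)
    qed
    finally show ?case using Suc by simp
  qed simp
  \<comment> \<open>\<open>insert 0\<close> keeps \<open>Max\<close> meaningful when
    \<open>A\<close> is empty.\<close>
  have "A \<subseteq> {D<..D + Max (insert 0 A)}"
    using assms by (auto intro!: trans_le_add2)
  hence "(\<Sum>d\<in>A. 1 / (real d)\<^sup>2) \<le> (\<Sum>d\<in>{D<..D+Max (insert 0 A)}. 1 / (real d)\<^sup>2)"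
    by (intro sum_mono2) auto
  also have "\<dots> \<le> 1 / real D" using *[of "Max (insert 0 A)"]
    by (smt (verit) of_nat_0_le_iff zero_le_divide_1_iff)
  finally show ?thesis .
qed

text \<open>The product over primes up to \<open>n\<close>, multiplied out, is a sum over the
  squarefree \<open>d\<close> built from the primes not dividing \<open>q\<close>. For
  \<open>n \<ge> D\<close> it contains every squarefree \<open>d \<le> D\<close> coprime to
  \<open>q\<close>, and every other term has \<open>d > D\<close>. So the difference is bounded by a
  tail of inverse squares, uniformly in \<open>n\<close>, and \<open>n\<close> can tend to
  infinity.\<close>

lemma sqfree_const_partial_sum:
  assumes D: "1 \<le> D" and q: "q > 0"
  shows "\<bar>(\<Sum>d | d \<in> {1..D} \<and> coprime d q. real_of_int (moebius_mu d) / (real d)\<^sup>2) - sqfree_const q\<bar> \<le> 1 / real D"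
proof -
  define g where "g = (\<lambda>p. if prime p \<and> \<not> p dvd q then 1 - 1 / (real p)\<^sup>2 else (1::real))"
  define f where "f = (\<lambda>p. 1 / (real p)\<^sup>2)"
  define S where "S = {d. d \<in> {1..D} \<and> coprime d q}"
  \<comment> \<open>Absolute convergence identifies \<open>sqfree_const\<close> with the limit of
    the partial products. The indices 0 and 1, where the factor is 1, are removed so that the tail
    bound applies beyond 1.\<close>
  have gb: "(\<Sum>p\<in>A. norm (g p - 1)) \<le> 2" if "finite A" for A
  proof -
    have "(\<Sum>p\<in>A. norm (g p - 1)) \<le> (\<Sum>p\<in>A. if p = 0 \<or> p = 1 then 0 else 1 / (real p)\<^sup>2)"
      by (intro sum_mono) (auto simp: g_def)
    also have "\<dots> = (\<Sum>p\<in>A - {0,1}. 1 / (real p)\<^sup>2)"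
      using that by (intro sum.mono_neutral_cong_right) auto
    also have "\<dots> \<le> 1 / real 1"
      using that by (intro sum_inverse_squares_le) auto
    finally show ?thesis by simp
  qed
  have "summable (\<lambda>p. norm (g p - 1))"
    by (rule bounded_imp_summable[where B = 2]) (use gb in auto)
  hence "convergent_prod g"
    by (intro abs_convergent_prod_imp_convergent_prod summable_imp_abs_convergent_prod)
  hence lim: "(\<lambda>n. \<Prod>p\<le>n. g p) \<longlonglongrightarrow> sqfree_const q"
    unfolding sqfree_const_def g_def by (rule convergent_prod_LIMSEQ)
  have key: "\<bar>(\<Sum>d\<in>S. real_of_int (moebius_mu d) / (real d)\<^sup>2) - (\<Prod>p\<le>n. g p)\<bar> \<le> 1 / real D"
    if n: "n \<ge> D" for n
  proof -
    define P where "P = {p. p \<le> n \<and> prime p \<and> \<not> p dvd q}"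
    have finP: "finite P" unfolding P_def by auto
    have primeP: "\<And>p. p \<in> P \<Longrightarrow> prime p" unfolding P_def by auto
    define Q where "Q = {d. squarefree d \<and> prime_factors d \<subseteq> P}"
    have finQ: "finite Q"
      using bij_betw_finite[OF bij_betw_prod_squarefree[OF finP primeP]] finP unfolding Q_def by simp
    have Q0: "d > 0" if "d \<in> Q" for d
      using that unfolding Q_def by (cases "d = 0") auto
    have "(\<Prod>p\<le>n. g p) = (\<Prod>p\<in>P. 1 - f p)"
      unfolding P_def by (rule prod.mono_neutral_cong_right) (auto simp: g_def f_def)
    also have "\<dots> = (\<Sum>d\<in>Q. real_of_int (moebius_mu d) * (\<Prod>p\<in>prime_factors d. f p))"
      using sum_moebius_mu_mult[OF finP primeP] unfolding Q_def by simp
    also have "\<dots> = (\<Sum>d\<in>Q. real_of_int (moebius_mu d) / (real d)\<^sup>2)"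
    proof (rule sum.cong[OF refl])
      fix d assume d: "d \<in> Q"
      hence "\<Prod>(prime_factors d) = d"
        unfolding Q_def by (intro prod_prime_factors_squarefree) simp
      hence "(\<Prod>p\<in>prime_factors d. f p) = 1 / (real d)\<^sup>2"
        unfolding f_def by (simp add: prod_dividef flip: prod_power_distrib of_nat_prod)
      thus "real_of_int (moebius_mu d) * (\<Prod>p\<in>prime_factors d. f p) = real_of_int (moebius_mu d) / (real d)\<^sup>2"
        by simp
    qed
    finally have eq: "(\<Prod>p\<le>n. g p) = (\<Sum>d\<in>Q. real_of_int (moebius_mu d) / (real d)\<^sup>2)" .
    have SQ: "d \<in> Q" if "d \<in> S" "squarefree d" for d
    proof -
      have "p \<in> P" if p: "p \<in> prime_factors d" for p
      proof -
        have "prime p" "p dvd d" using p by auto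
        moreover have "p \<le> n" using \<open>p dvd d\<close> \<open>d \<in> S\<close> n dvd_imp_le[of p d] unfolding S_def by simp
        moreover have "\<not> p dvd q" using \<open>d \<in> S\<close> calculation(1,2) unfolding S_def
          by (metis (lifting) coprime_common_divisor mem_Collect_eq not_prime_unit)
        ultimately show ?thesis unfolding P_def by auto
      qed
      thus ?thesis unfolding Q_def using that by auto
    qed
    have QS: "d \<in> S" if d: "d \<in> Q" "d \<le> D" for d
    proof -
      have "coprime d q"
      proof (rule ccontr)
        assume "\<not> coprime d q"
        then obtain p where "prime p" "p dvd d" "p dvd q"
          by (metis coprime_iff_gcd_eq_1 gcd_nat.boundedE prime_factor_nat)
        hence "p \<in> prime_factors d" using Q0[OF d(1)] by (simp add: in_prime_factors_iff)
        thus False using d(1) \<open>p dvd q\<close> unfolding Q_def P_def by auto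
      qed
      thus ?thesis using Q0[OF d(1)] d(2) unfolding S_def by auto
    qed
    \<comment> \<open>\<open>S\<close> also contains integers that are not squarefree, on which
      \<open>moebius_mu\<close> is 0.\<close>
    have "(\<Sum>d\<in>S. real_of_int (moebius_mu d) / (real d)\<^sup>2) = (\<Sum>d\<in>Q \<inter> S. real_of_int (moebius_mu d) / (real d)\<^sup>2)"
      by (rule sum.mono_neutral_right) (use SQ in \<open>auto simp: S_def moebius_mu_def\<close>)
    hence "(\<Sum>d\<in>S. real_of_int (moebius_mu d) / (real d)\<^sup>2) - (\<Prod>p\<le>n. g p)
             = - (\<Sum>d\<in>Q - S. real_of_int (moebius_mu d) / (real d)\<^sup>2)"
      unfolding eq using sum.Int_Diff[OF finQ, of "\<lambda>d. real_of_int (moebius_mu d) / (real d)\<^sup>2" S] by linarith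
    hence "\<bar>(\<Sum>d\<in>S. real_of_int (moebius_mu d) / (real d)\<^sup>2) - (\<Prod>p\<le>n. g p)\<bar>
             = \<bar>\<Sum>d\<in>Q - S. real_of_int (moebius_mu d) / (real d)\<^sup>2\<bar>" by simp
    also have "\<dots> \<le> (\<Sum>d\<in>Q - S. \<bar>real_of_int (moebius_mu d) / (real d)\<^sup>2\<bar>)" by (rule sum_abs)
    also have "\<dots> \<le> (\<Sum>d\<in>Q - S. 1 / (real d)\<^sup>2)"
      using abs_moebius_mu_le by (intro sum_mono) (simp add: abs_divide divide_right_mono)
    also have "\<dots> \<le> 1 / real D"
      using D finQ QS by (intro sum_inverse_squares_le) (auto simp: not_le[symmetric])
    finally show ?thesis .
  qed
  have "(\<lambda>n. \<bar>(\<Sum>d\<in>S. real_of_int (moebius_mu d) / (real d)\<^sup>2) - (\<Prod>p\<le>n. g p)\<bar>)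
          \<longlonglongrightarrow> \<bar>(\<Sum>d\<in>S. real_of_int (moebius_mu d) / (real d)\<^sup>2) - sqfree_const q\<bar>"
    by (intro tendsto_intros lim)
  thus ?thesis unfolding S_def[symmetric] by (rule LIMSEQ_le_const2) (use key in blast)
qed

section \<open>Divisor bounds\<close>

text \<open>The number of divisors of \<open>n > 0\<close> in product form, which lets the totient
  comparison and the power bound be proved one prime at a time.\<close>

definition divisor_prod :: "nat \<Rightarrow> nat" where
  "divisor_prod n = (\<Prod>p\<in>prime_factors n. multiplicity p n + 1)"

lemma card_divisors_le_divisor_prod:
  assumes n: "n > 0"
  shows "card {d. d dvd n} \<le> divisor_prod n"
proof -
  define F where "F = (\<lambda>d. restrict (\<lambda>p. multiplicity p d) (prime_factors n))"
  have inj: "inj_on F {d. d dvd n}"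
  proof (rule inj_onI)
    fix a b assume ab: "a \<in> {d. d dvd n}" "b \<in> {d. d dvd n}" "F a = F b"
    have pos: "a > 0" "b > 0" using ab n by (auto intro: Nat.gr0I)
    have "multiplicity p a = multiplicity p b" if p: "prime p" for p
    proof (cases "p \<in> prime_factors n")
      case True
      thus ?thesis using fun_cong[OF ab(3), of p] by (simp add: F_def)
    next
      case False
      hence "\<not> p dvd n" using p n by (simp add: in_prime_factors_iff)
      hence "\<not> p dvd a" "\<not> p dvd b" using ab by (auto dest: dvd_trans)
      thus ?thesis by (simp add: not_dvd_imp_multiplicity_0)
    qed
    thus "a = b" by (rule multiplicity_eq_nat[OF pos])
  qed
  have sub: "F ` {d. d dvd n} \<subseteq> (\<Pi>\<^sub>E p\<in>prime_factors n. {..multiplicity p n})"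
    using n by (auto simp: F_def dvd_imp_multiplicity_le split: if_splits)
  have "card {d. d dvd n} = card (F ` {d. d dvd n})" using inj by (simp add: card_image)
  also have "\<dots> \<le> card (\<Pi>\<^sub>E p\<in>prime_factors n. {..multiplicity p n})"
    by (intro card_mono sub finite_PiE) auto
  also have "\<dots> = divisor_prod n"
    by (simp add: card_PiE divisor_prod_def)
  finally show ?thesis .
qed

text \<open>As \<open>totient n / n\<close> is the product of the \<open>1 - 1 / p\<close>, it
  suffices that each \<open>(1 - 1 / p) * (multiplicity p n + 1)\<close> is at least
  \<open>(1/2) * 2\<close>. This pays for averaging over all residues.\<close>

lemma le_totient_mult_divisor_prod:
  assumes "n > 0"
  shows "real n \<le> real (totient n) * real (divisor_prod n)"
proof -
  have "1 \<le> (\<Prod>p\<in>prime_factors n. (1 - 1 / real p) * real (multiplicity p n + 1))"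
  proof (rule prod_ge_1)
    fix p assume p: "p \<in> prime_factors n"
    hence "p \<ge> 2" "multiplicity p n > 0"
      by (auto simp: prime_factors_multiplicity prime_ge_2_nat)
    hence "1 / real p \<le> 1 / 2" "real (multiplicity p n + 1) \<ge> 2" by (auto simp: field_simps)
    hence "(1 - 1 / real p) * real (multiplicity p n + 1) \<ge> (1/2) * 2"
      by (intro mult_mono) auto
    thus "1 \<le> (1 - 1 / real p) * real (multiplicity p n + 1)" by simp
  qed
  hence "real n * 1 \<le> real n * ((\<Prod>p\<in>prime_factors n. 1 - 1 / real p) * real (divisor_prod n))"
    by (intro mult_left_mono) (auto simp: prod.distrib divisor_prod_def)
  thus ?thesis by (simp add: totient_formula2 mult.assoc)
qed

text \<open>Compare \<open>multiplicity p n + 1\<close> with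
  \<open>p powr (\<delta> * multiplicity p n)\<close> for each prime. Beyond \<open>T\<close> one
  has \<open>p powr \<delta> \<ge> 2\<close> and nothing is lost, since
  \<open>a + 1 \<le> 2 ^ a\<close>; each of the at most \<open>T\<close> smaller primes loses a
  factor \<open>B\<close>.\<close>

lemma divisor_prod_le_powr:
  fixes \<delta> :: real
  assumes \<delta>: "\<delta> > 0"
  shows "\<exists>C>0. \<forall>n>0. real (divisor_prod n) \<le> C * real n powr \<delta>"
proof -
  \<comment> \<open>Chosen so that \<open>B * (1 + \<delta> * a * ln 2)\<close> is at least
    \<open>1 + a\<close> for every \<open>a\<close>.\<close>
  define B where "B = 1 + 1 / (\<delta> * ln 2)"
  define T where "T = nat \<lceil>2 powr (1 / \<delta>)\<rceil>"
  have B1: "B \<ge> 1" using \<delta> by (simp add: B_def)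
  have small: "real (a + 1) \<le> B * real p powr (\<delta> * real a)" if "p \<ge> 2" for p a :: nat
  proof -
    have "1 + \<delta> * real a * ln 2 \<le> exp (\<delta> * real a * ln 2)" by (rule exp_ge_add_one_self)
    also have "\<dots> = 2 powr (\<delta> * real a)" by (simp add: powr_def)
    also have "\<dots> \<le> real p powr (\<delta> * real a)" using that \<delta> by (intro powr_mono2) auto
    finally have "B * (1 + \<delta> * real a * ln 2) \<le> B * real p powr (\<delta> * real a)"
      using B1 by (intro mult_left_mono) auto
    moreover have "B * (1 + \<delta> * real a * ln 2) = 1 + real a + (1 / (\<delta> * ln 2) + \<delta> * real a * ln 2)"
      using \<delta> by (simp add: B_def field_simps)
    moreover have "0 \<le> 1 / (\<delta> * ln 2) + \<delta> * real a * ln 2" using \<delta> by simp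
    ultimately show ?thesis by simp
  qed
  have large: "real (a + 1) \<le> real p powr (\<delta> * real a)" if "p > T" for p a :: nat
  proof -
    have "2 powr (1 / \<delta>) \<le> real p" using that unfolding T_def by linarith
    hence "(2 powr (1 / \<delta>)) powr \<delta> \<le> real p powr \<delta>" using \<delta> by (intro powr_mono2) auto
    hence "2 \<le> real p powr \<delta>" using \<delta> by (simp add: powr_powr)
    hence "2 ^ a \<le> (real p powr \<delta>) ^ a" by (intro power_mono) auto
    also have "\<dots> = real p powr (\<delta> * real a)" 
      using that by (simp add: powr_realpow[symmetric] powr_powr)
    finally show ?thesis using of_nat_mono[OF Suc_leI[OF less_exp[of a]], where 'a = real] by simp
  qed
  have "real (divisor_prod n) \<le> B ^ T * real n powr \<delta>" if n: "n > 0" for n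
  proof -
    have "real (divisor_prod n) = (\<Prod>p\<in>prime_factors n. real (multiplicity p n + 1))"
      by (simp add: divisor_prod_def)
    also have "\<dots> \<le> (\<Prod>p\<in>prime_factors n. (if p \<le> T then B else 1) * real p powr (\<delta> * real (multiplicity p n)))"
      using small large by (intro prod_mono) (auto simp: in_prime_factors_iff prime_ge_2_nat not_le simp del: of_nat_add)
    also have "\<dots> = (\<Prod>p\<in>prime_factors n. (if p \<le> T then B else 1)) * (\<Prod>p\<in>prime_factors n. real p powr (\<delta> * real (multiplicity p n)))"
      by (rule prod.distrib)
    finally have le: "real (divisor_prod n) \<le> (\<Prod>p\<in>prime_factors n. (if p \<le> T then B else 1)) * (\<Prod>p\<in>prime_factors n. real p powr (\<delta> * real (multiplicity p n)))" .
    have "(\<Prod>p\<in>prime_factors n. (if p \<le> T then B else 1)) = (\<Prod>p\<in>prime_factors n \<inter> {1..T}. B)"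
      by (rule prod.mono_neutral_cong_right) (auto simp: in_prime_factors_iff Suc_leI prime_gt_0_nat)
    also have "\<dots> = B ^ card (prime_factors n \<inter> {1..T})" by simp
    also have "\<dots> \<le> B ^ T"
    proof (rule power_increasing[OF _ B1])
      have "card (prime_factors n \<inter> {1..T}) \<le> card {1..T}" by (intro card_mono) auto
      thus "card (prime_factors n \<inter> {1..T}) \<le> T" by simp
    qed
    finally have BT: "(\<Prod>p\<in>prime_factors n. (if p \<le> T then B else 1)) \<le> B ^ T" .
    have "(\<Prod>p\<in>prime_factors n. real p powr (\<delta> * real (multiplicity p n)))
            = (\<Prod>p\<in>prime_factors n. (real p ^ multiplicity p n) powr \<delta>)"
    proof (rule prod.cong[OF refl])
      fix p assume "p \<in> prime_factors n"
      hence "real p > 0" by (simp add: prime_gt_0_nat in_prime_factors_iff)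
      thus "real p powr (\<delta> * real (multiplicity p n)) = (real p ^ multiplicity p n) powr \<delta>"
        by (simp add: powr_realpow[symmetric] powr_powr mult.commute)
    qed
    also have "\<dots> = (\<Prod>p\<in>prime_factors n. real p ^ multiplicity p n) powr \<delta>"
      by (rule prod_powr_distrib[symmetric])
    also have "(\<Prod>p\<in>prime_factors n. real p ^ multiplicity p n) = real n"
      using arg_cong[OF prime_factorization_nat[OF n], of real] unfolding of_nat_prod of_nat_power by (rule sym)
    finally have "(\<Prod>p\<in>prime_factors n. real p powr (\<delta> * real (multiplicity p n))) = real n powr \<delta>" .
    thus ?thesis using le mult_right_mono[OF BT, of "real n powr \<delta>"] by simp
  qed
  thus ?thesis using B1 by (intro exI[of _ "B ^ T"]) auto
qed

lemma harm_le_powr: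
  fixes \<delta> :: real
  assumes "\<delta> > 0" "n > 0"
  shows "harm n \<le> (1 + 1 / \<delta>) * real n powr \<delta>"
proof -
  have "harm n - ln (real n) \<le> harm 1 - ln (real 1)"
    using assms decseqD[OF decseq_harm_diff_ln, of 0 "n - 1"] by simp
  hence "harm n \<le> 1 + ln (real n)" by (simp add: harm_expand)
  also have "\<dots> \<le> real n powr \<delta> + real n powr \<delta> / \<delta>"
    using assms by (intro add_mono ge_one_powr_ge_zero ln_powr_bound) auto
  finally show ?thesis by (simp only: distrib_right mult_1_left times_divide_eq_left)
qed

section \<open>Congruences and lattice points\<close>

text \<open>
With \<open>n = q / gcd h q\<close>, any two solutions satisfy \<open>n dvd (t - t0) * (t + t0)\<close>. Hence \<open>t\<close> is determined
modulo \<open>n / 2\<close> by \<open>gcd (t - t0) n\<close>, because a common factor of \<open>t - t0\<close> and \<open>t + t0\<close> divides 2.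
\<close>

lemma card_square_ratio_le:
  fixes h k q :: nat
  assumes q: "q > 0"
  shows "card {t. t < q \<and> coprime t q \<and> [h * t\<^sup>2 = k] (mod q)} \<le> 2 * gcd h q * card {d. d dvd q}"
proof (cases "{t. t < q \<and> coprime t q \<and> [h * t\<^sup>2 = k] (mod q)} = {}")
  case False
  define A where "A = {t. t < q \<and> coprime t q \<and> [h * t\<^sup>2 = k] (mod q)}"
  have finA: "finite A" unfolding A_def by auto
  define e where "e = gcd h q"
  define n where "n = q div e"
  have e0: "e > 0" using q by (simp add: e_def)
  have qe: "q = e * n" unfolding n_def e_def by simp
  have n0: "n > 0" using q qe by (cases n) auto
  obtain t0 where t0: "t0 \<in> A" using False unfolding A_def by blast
  have dv: "int n dvd (int t - int t0) * (int t + int t0)" if "t \<in> A" for t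
  proof -
    have "[h * t\<^sup>2 = h * t0\<^sup>2] (mod q)" using that t0 unfolding A_def
      by (auto intro: cong_trans cong_sym)
    hence "[int (h * t\<^sup>2) = int (h * t0\<^sup>2)] (mod int q)" by (simp only: cong_int_iff)
    hence "int q dvd int h * ((int t)\<^sup>2 - (int t0)\<^sup>2)"
      by (simp add: cong_iff_dvd_diff algebra_simps)
    moreover have "h = e * (h div e)" by (simp add: e_def)
    ultimately have "int e * int n dvd int e * (int (h div e) * ((int t)\<^sup>2 - (int t0)\<^sup>2))"
      using qe by (metis mult.assoc of_nat_mult)
    hence "int n dvd int (h div e) * ((int t)\<^sup>2 - (int t0)\<^sup>2)" using e0 by simp
    moreover have "coprime n (h div e)"
      using q unfolding n_def e_def by (metis coprime_commute div_gcd_coprime not_gr_zero)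
    hence "coprime (int n) (int (h div e))" by simp
    ultimately have "int n dvd (int t)\<^sup>2 - (int t0)\<^sup>2" using coprime_dvd_mult_right_iff by blast
    thus ?thesis by (simp add: power2_eq_square algebra_simps)
  qed
  define G where "G = (\<lambda>t. gcd (int t - int t0) (int n))"
  \<comment> \<open>The gcd fixes \<open>2 * t\<close> modulo \<open>n\<close>; the second entry
    tells which interval of length \<open>n / 2\<close> contains \<open>t\<close>. As
    \<open>t < q = e * n\<close>, there are \<open>2 * e\<close> such intervals.\<close>
  define F where "F = (\<lambda>t. (nat (G t), 2 * t div n))"
  have inj: "inj_on F A"
  proof (rule inj_onI)
    fix s t assume st: "s \<in> A" "t \<in> A" "F s = F t"
    have "G s \<ge> 0" "G t \<ge> 0" by (auto simp: G_def)
    hence gg: "G s = G t" using st(3) by (simp add: F_def eq_nat_nat_iff)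
    define g where "g = G s"
    have gpos: "g > 0" using n0 by (simp add: g_def G_def)
    obtain m where m: "int n = g * m" using g_def G_def by (metis dvd_def gcd_dvd2)
    have mdvd: "m dvd int u + int t0" if u: "u \<in> A" "G u = g" for u
    proof -
      obtain w where w: "int u - int t0 = g * w" using u(2) G_def by (metis dvd_def gcd_dvd1)
      \<comment> \<open>Since \<open>g\<close> is the full gcd, the cofactor \<open>w\<close> is
        coprime to \<open>m\<close>, which forces \<open>m\<close> to divide the other factor
        \<open>u + t0\<close>.\<close>
      have "gcd (g * w) (g * m) = g" using u(2) w m unfolding G_def by simp
      hence "g * gcd w m = g" using gpos by (simp add: gcd_mult_left)
      hence "coprime w m" using gpos by (simp add: coprime_iff_gcd_eq_1)
      moreover have "g * m dvd g * (w * (int u + int t0))" using dv[OF u(1)] w m by (simp add: mult.assoc)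
      hence "m dvd w * (int u + int t0)" using gpos by simp
      ultimately show ?thesis using coprime_commute coprime_dvd_mult_right_iff by blast
    qed
    have gdvd: "g dvd int u - int t0" if "G u = g" for u using that by (auto simp: G_def)
    have 1: "g dvd int s - int t" using gdvd[of s] gdvd[of t] gg g_def dvd_diff[of g "int s - int t0" "int t - int t0"] by simp
    have 2: "m dvd int s - int t"
      using mdvd[OF st(1)] mdvd[OF st(2)] gg g_def dvd_diff[of m "int s + int t0" "int t + int t0"] by simp
    define c where "c = gcd g m"
    have "c dvd int s - int t0" "c dvd int s + int t0"
      using gdvd[of s] mdvd[OF st(1)] g_def unfolding c_def by (auto intro: dvd_trans)
    hence "c dvd 2 * int t0" using dvd_diff[of c "int s + int t0" "int s - int t0"] by simp
    moreover have "coprime c (int t0)"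
    proof -
      have "coprime (int t0) (int q)" using t0 unfolding A_def by simp
      moreover have "c dvd int q" unfolding c_def qe using m by (simp add: dvd_mult dvd_mult2)
      ultimately show ?thesis by (metis coprime_commute coprime_divisors dvd_refl)
    qed
    ultimately have "c dvd 2" using coprime_dvd_mult_left_iff by blast
    \<comment> \<open>Both \<open>g\<close> and \<open>m\<close> divide \<open>s - t\<close>, hence
      so does their lcm; this is the same fact multiplied by their gcd \<open>c\<close>.\<close>
    have "g * m dvd c * (int s - int t)"
    proof -
      have "g * m dvd g * (int s - int t)" "g * m dvd m * (int s - int t)"
        using 1 2 by (auto simp: mult.commute)
      hence "g * m dvd gcd (g * (int s - int t)) (m * (int s - int t))" by simp
      also have "\<dots> = \<bar>c * (int s - int t)\<bar>"
        unfolding c_def by (simp add: gcd_mult_right abs_mult gcd.commute)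
      finally show ?thesis by simp
    qed
    hence "int n dvd 2 * (int s - int t)" using \<open>c dvd 2\<close> m
      by (metis dvd_trans mult_dvd_mono dvd_refl)
    hence "[2 * s = 2 * t] (mod n)" 
      by (simp add: cong_iff_dvd_diff right_diff_distrib flip: cong_int_iff)
    moreover have "2 * s div n = 2 * t div n" using st(3) by (simp add: F_def)
    ultimately have "2 * s = 2 * t" unfolding cong_def by (metis div_mult_mod_eq)
    thus "s = t" by simp
  qed
  have "F ` A \<subseteq> {d. d dvd q} \<times> {..<2*e}"
  proof (rule image_subsetI)
    fix t assume t: "t \<in> A"
    have "G t dvd int n" by (simp add: G_def)
    hence "nat (G t) dvd n" using nat_dvd_iff by (metis G_def gcd_ge_0_int int_dvd_int_iff nat_0_le)
    hence "nat (G t) dvd q" using qe by simp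
    moreover have "2 * t div n < 2 * e"
    proof -
      have "2 * t < 2 * e * n" using t qe unfolding A_def by simp
      thus ?thesis using n0 by (simp add: div_less_iff_less_mult)
    qed
    ultimately show "F t \<in> {d. d dvd q} \<times> {..<2*e}" by (simp add: F_def)
  qed
  hence "card (F ` A) \<le> card ({d. d dvd q} \<times> {..<2*e})" using q by (intro card_mono) auto
  thus ?thesis using inj by (simp add: card_image card_cartesian_product A_def e_def mult.commute)
next
  case True
  show ?thesis unfolding True by simp
qed

text \<open>Two distinct slopes \<open>a / b\<close> and \<open>a' / b'\<close> in the unit interval differ by at least \<open>q / P\<^sup>2\<close>.\<close>

lemma card_coprime_pairs_det_dvd_le:
  fixes A :: "(nat \<times> nat) set"
  assumes q: "q > 0"
    and A: "\<And>a b. (a, b) \<in> A \<Longrightarrow> 0 < b \<and> a \<le> b \<and> b \<le> P \<and> coprime a b"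
    and det: "\<And>a b a' b'. (a, b) \<in> A \<Longrightarrow> (a', b') \<in> A \<Longrightarrow> int q dvd int a * int b' - int a' * int b"
  shows "real (card A) \<le> 1 + (real P)\<^sup>2 / real q"
proof -
  \<comment> \<open>Slopes are stretched by the inverse of the bound on their gaps, so distinct
    pairs get distinct integer parts. As \<open>a \<le> b\<close>, the values stay below
    \<open>P\<^sup>2 / q\<close>, up to equality.\<close>
  define F where "F = (\<lambda>(a, b). nat \<lfloor>real a / real b * ((real P)\<^sup>2 / real q)\<rfloor>)"
  define Z where "Z = nat \<lfloor>(real P)\<^sup>2 / real q\<rfloor>"
  have inj: "inj_on F A"
  proof (rule inj_onI)
    fix x y assume xy: "x \<in> A" "y \<in> A" "F x = F y"
    obtain a b a' b' where ab: "x = (a, b)" "y = (a', b')" by (metis surj_pair)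
    have 1: "(a, b) \<in> A" and 2: "(a', b') \<in> A" and eq: "F (a, b) = F (a', b')"
      using xy ab by auto
    note AB = A[OF 1] A[OF 2]
    define u where "u = real a / real b * ((real P)\<^sup>2 / real q)"
    define u' where "u' = real a' / real b' * ((real P)\<^sup>2 / real q)"
    have "u \<ge> 0" "u' \<ge> 0" by (auto simp: u_def u'_def)
    moreover have "nat \<lfloor>u\<rfloor> = nat \<lfloor>u'\<rfloor>" using eq by (simp add: F_def u_def u'_def)
    ultimately have "\<lfloor>u\<rfloor> = \<lfloor>u'\<rfloor>" by (simp add: eq_nat_nat_iff)
    hence lt: "\<bar>u - u'\<bar> < 1" by linarith
    define D where "D = int a * int b' - int a' * int b"
    have "D = 0"
    proof (rule ccontr)
      assume "D \<noteq> 0"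
      moreover have "int q dvd D" unfolding D_def by (rule det[OF 1 2])
      ultimately have "int q \<le> \<bar>D\<bar>" using zdvd_imp_le[of "int q" "\<bar>D\<bar>"] by simp
      hence qD: "real q \<le> \<bar>real_of_int D\<bar>" by linarith
      have "real b * real b' \<le> (real P)\<^sup>2"
        unfolding power2_eq_square using AB by (intro mult_mono) auto
      hence "real q * (real b * real b') \<le> \<bar>real_of_int D\<bar> * (real P)\<^sup>2"
        using qD by (intro mult_mono) auto
      hence "1 \<le> \<bar>real_of_int D\<bar> * (real P)\<^sup>2 / (real q * (real b * real b'))"
        using q AB by (simp add: le_divide_eq)
      also have "\<dots> = \<bar>real_of_int D * (real P)\<^sup>2 / (real q * (real b * real b'))\<bar>"
        by (simp add: abs_mult)
      also have "real_of_int D * (real P)\<^sup>2 / (real q * (real b * real b')) = u - u'"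
        unfolding u_def u'_def D_def using q AB by (simp add: field_simps)
      finally show False using lt by simp
    qed
    hence "a * b' = a' * b" unfolding D_def by (metis eq_iff_diff_eq_0 of_nat_eq_iff of_nat_mult)
    moreover have "coprime a b" "coprime a' b'" using AB by auto
    ultimately show "x = y"
      using coprime_crossproduct_nat[of a b a' b'] ab by (simp add: mult.commute coprime_commute)
  qed
  have "F ` A \<subseteq> {..Z}"
  proof (rule image_subsetI)
    fix x assume x: "x \<in> A"
    obtain a b where ab: "x = (a, b)" by (cases x)
    hence "(a, b) \<in> A" using x by simp
    hence "real a / real b \<le> 1" using A by (simp add: divide_le_eq_1)
    hence "real a / real b * ((real P)\<^sup>2 / real q) \<le> 1 * ((real P)\<^sup>2 / real q)"
      by (intro mult_right_mono) auto
    thus "F x \<in> {..Z}" unfolding ab F_def Z_def by (simp add: nat_mono floor_mono)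
  qed
  hence "card (F ` A) \<le> card {..Z}" by (intro card_mono) auto
  hence "card A \<le> Z + 1" using inj by (simp add: card_image)
  moreover have "real Z \<le> (real P)\<^sup>2 / real q" unfolding Z_def by simp
  ultimately show ?thesis by linarith
qed

text \<open>The pairs lie in a lattice in which all 2 by 2 determinants are multiples of
  \<open>q\<close>. The half with \<open>a \<le> b\<close> has slopes at most 1, as the previous
  bound requires, and the other half is reflected; hence the factor 2.\<close>

lemma card_coprime_pairs_cong_le:
  fixes P q t :: nat
  assumes q: "q > 0"
  shows "real (card {(a, b). a \<in> {1..P} \<and> b \<in> {1..P} \<and> coprime a b \<and> [a = t * b] (mod q)})
           \<le> 2 * (1 + (real P)\<^sup>2 / real q)"
proof -
  define L where "L = {(a, b). a \<in> {1..P} \<and> b \<in> {1..P} \<and> coprime a b \<and> [a = t * b] (mod q)}"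
  define L1 where "L1 = {(a, b). (a, b) \<in> L \<and> a \<le> b}"
  define L2 where "L2 = {(b, a). (a, b) \<in> L \<and> b \<le> a}"
  have "L \<subseteq> {1..P} \<times> {1..P}" unfolding L_def by auto
  hence fin: "finite L" by (rule finite_subset) auto
  have fin1: "finite L1" unfolding L1_def by (rule finite_subset[OF _ fin]) auto
  have L2: "L2 = prod.swap ` {(a, b). (a, b) \<in> L \<and> b \<le> a}"
    unfolding L2_def by force
  have fin2: "finite {(a, b). (a, b) \<in> L \<and> b \<le> a}" by (rule finite_subset[OF _ fin]) auto
  have c2: "card L2 = card {(a, b). (a, b) \<in> L \<and> b \<le> a}"
    unfolding L2 by (intro card_image) (auto intro: inj_onI)
  have det: "int q dvd int a * int b' - int a' * int b" if "(a, b) \<in> L" "(a', b') \<in> L" for a b a' b'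
  proof -
    have "[int a = int t * int b] (mod int q)" "[int a' = int t * int b'] (mod int q)"
      using that unfolding L_def by (auto simp flip: of_nat_mult simp: cong_int_iff)
    hence "[int a * int b' - int a' * int b = (int t * int b) * int b' - (int t * int b') * int b] (mod int q)"
      by (intro cong_diff cong_mult cong_refl)
    thus ?thesis by (simp add: cong_iff_dvd_diff algebra_simps)
  qed
  have "real (card L1) \<le> 1 + (real P)\<^sup>2 / real q"
    by (rule card_coprime_pairs_det_dvd_le[OF q]) (use det in \<open>auto simp: L1_def L_def\<close>)
  moreover have "real (card L2) \<le> 1 + (real P)\<^sup>2 / real q"
  proof (rule card_coprime_pairs_det_dvd_le[OF q])
    fix a b a' b' assume "(a, b) \<in> L2" "(a', b') \<in> L2"
    hence "(b, a) \<in> L" "(b', a') \<in> L" unfolding L2_def by auto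
    from det[OF this] have "int q dvd - (int b * int a' - int b' * int a)" by (simp only: dvd_minus_iff)
    thus "int q dvd int a * int b' - int a' * int b" by (simp add: mult.commute)
  qed (auto simp: L2_def L_def coprime_commute)
  moreover have "card L \<le> card L1 + card L2"
  proof -
    have "card L \<le> card (L1 \<union> {(a, b). (a, b) \<in> L \<and> b \<le> a})"
      using fin1 fin2 by (intro card_mono) (auto simp: L1_def)
    also have "\<dots> \<le> card L1 + card {(a, b). (a, b) \<in> L \<and> b \<le> a}" by (rule card_Un_le)
    finally show ?thesis using c2 by simp
  qed
  ultimately show ?thesis unfolding L_def[symmetric] by (smt (verit) of_nat_add of_nat_mono)
qed

section \<open>Averages of the weights that bound geometric sums\<close>

text \<open>For \<open>0 < k < q\<close> this equals \<open>q / (k * (q - k))\<close>, a rational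
  stand-in for the inverse distance from \<open>k\<close> to the nearest multiple of
  \<open>q\<close>. Times \<open>q\<close> it bounds every geometric sum of frequency
  \<open>k\<close>.\<close>

definition recip_sym :: "nat \<Rightarrow> nat \<Rightarrow> real" where
  "recip_sym q k = 1 / real k + 1 / real (q - k)"

lemma recip_sym_nonneg: "recip_sym q k \<ge> 0"
  by (simp add: recip_sym_def)

lemma sum_inverse_multiples_le:
  fixes e N :: nat
  assumes e: "e > 0"
  shows "(\<Sum>k | k \<in> {1..N} \<and> e dvd k. 1 / real k) \<le> harm N / real e"
proof -
  have "(\<Sum>k | k \<in> {1..N} \<and> e dvd k. 1 / real k) \<le> (\<Sum>k\<in>(\<lambda>j. e * j) ` {1..N}. 1 / real k)"
  proof (rule sum_mono2)
    show "{k. k \<in> {1..N} \<and> e dvd k} \<subseteq> (\<lambda>j. e * j) ` {1..N}"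
    proof
      fix k assume "k \<in> {k. k \<in> {1..N} \<and> e dvd k}"
      then obtain j where j: "k = e * j" "1 \<le> k" "k \<le> N" by (auto elim: dvdE)
      have "j \<le> e * j" using e by (cases e) auto
      hence "j \<le> N" using j by linarith
      moreover have "1 \<le> j" using j by (cases j) auto
      ultimately show "k \<in> (\<lambda>j. e * j) ` {1..N}" using j by auto
    qed
  qed auto
  also have "\<dots> = (\<Sum>j\<in>{1..N}. 1 / real e * (1 / real j))"
    using e by (subst sum.reindex) (auto intro!: inj_onI)
  also have "\<dots> = harm N / real e"
    by (simp add: harm_def sum_divide_distrib inverse_eq_divide mult.commute)
  finally show ?thesis .
qed

text \<open>As \<open>e\<close> divides \<open>q\<close>, sending \<open>k\<close> to
  \<open>q - k\<close> permutes the multiples of \<open>e\<close>, so both halves of the weight have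
  equal sums. The factor \<open>1 / e\<close> will cancel the \<open>gcd h q\<close> in the number
  of solutions of \<open>h * t\<^sup>2 = k\<close>.\<close>

lemma sum_recip_sym_multiples_le:
  assumes e: "e dvd q" "e > 0"
  shows "(\<Sum>k | k \<in> {1..<q} \<and> e dvd k. recip_sym q k) \<le> 2 / real e * harm q"
proof -
  define K where "K = {k. k \<in> {1..<q} \<and> e dvd k}"
  have "bij_betw (\<lambda>k. q - k) K K"
    by (rule bij_betw_byWitness[where f' = "\<lambda>k. q - k"]) (use e in \<open>auto simp: K_def dvd_diff_nat\<close>)
  hence "(\<Sum>k\<in>K. 1 / real (q - k)) = (\<Sum>k\<in>K. 1 / real k)"
    by (rule sum.reindex_bij_betw)
  hence "(\<Sum>k\<in>K. recip_sym q k) = 2 * (\<Sum>k\<in>K. 1 / real k)"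
    by (simp add: recip_sym_def sum.distrib)
  also have "(\<Sum>k\<in>K. 1 / real k) \<le> (\<Sum>k | k \<in> {1..q} \<and> e dvd k. 1 / real k)"
    by (rule sum_mono2) (auto simp: K_def)
  also have "\<dots> \<le> harm q / real e" by (rule sum_inverse_multiples_le[OF e(2)])
  finally show ?thesis by (simp add: K_def)
qed

text \<open>Bounding \<open>gcd a b\<close> by the sum of all common divisors separates the
  variables; a common divisor \<open>g\<close> then contributes at most
  \<open>g * (harm N / g)\<^sup>2\<close>.\<close>

lemma sum_gcd_div_le:
  "(\<Sum>a\<in>{1..N}. \<Sum>b\<in>{1..N}. real (gcd a b) / (real a * real b)) \<le> (harm N) ^ 3"
proof -
  have "(\<Sum>a\<in>{1..N}. \<Sum>b\<in>{1..N}. real (gcd a b) / (real a * real b))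
     \<le> (\<Sum>a\<in>{1..N}. \<Sum>b\<in>{1..N}. \<Sum>g\<in>{1..N}. real g * ((if g dvd a then 1 / real a else 0) * (if g dvd b then 1 / real b else 0)))"
  proof (intro sum_mono)
    fix a b assume ab: "a \<in> {1..N}" "b \<in> {1..N}"
    have "gcd a b \<le> a" using ab by (intro dvd_imp_le) auto
    hence "gcd a b \<le> N" using ab by (meson atLeastAtMost_iff le_trans)
    moreover have "gcd a b \<noteq> 0" using ab by simp
    ultimately have g: "gcd a b \<in> {1..N}" by (simp add: Suc_le_eq)
    have "real (gcd a b) / (real a * real b)
       = real (gcd a b) * ((if gcd a b dvd a then 1 / real a else 0) * (if gcd a b dvd b then 1 / real b else 0))"
      by simp
    also have "\<dots> \<le> (\<Sum>g\<in>{1..N}. real g * ((if g dvd a then 1 / real a else 0) * (if g dvd b then 1 / real b else 0)))"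
      by (rule member_le_sum[OF g]) auto
    finally show "real (gcd a b) / (real a * real b) \<le> (\<Sum>g\<in>{1..N}. real g * ((if g dvd a then 1 / real a else 0) * (if g dvd b then 1 / real b else 0)))" .
  qed
  also have "\<dots> = (\<Sum>a\<in>{1..N}. \<Sum>g\<in>{1..N}. \<Sum>b\<in>{1..N}. real g * ((if g dvd a then 1 / real a else 0) * (if g dvd b then 1 / real b else 0)))"
    by (intro sum.cong refl sum.swap)
  also have "\<dots> = (\<Sum>g\<in>{1..N}. \<Sum>a\<in>{1..N}. \<Sum>b\<in>{1..N}. real g * ((if g dvd a then 1 / real a else 0) * (if g dvd b then 1 / real b else 0)))"
    by (rule sum.swap)
  also have "\<dots> = (\<Sum>g\<in>{1..N}. real g * (\<Sum>a\<in>{1..N}. if g dvd a then 1 / real a else 0)\<^sup>2)"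
    unfolding power2_eq_square sum_product by (simp only: sum_distrib_left)
  also have "\<dots> \<le> (\<Sum>g\<in>{1..N}. 1 / real g * (harm N)\<^sup>2)"
  proof (rule sum_mono)
    fix g assume g: "g \<in> {1..N}"
    have "(\<Sum>a\<in>{1..N}. if g dvd a then 1 / real a else 0) = (\<Sum>k | k \<in> {1..N} \<and> g dvd k. 1 / real k)"
      by (rule sum.inter_filter[symmetric]) simp
    also have "\<dots> \<le> harm N / real g" using g by (intro sum_inverse_multiples_le) auto
    finally have "(\<Sum>a\<in>{1..N}. if g dvd a then 1 / real a else 0)\<^sup>2 \<le> (harm N / real g)\<^sup>2"
      by (intro power_mono sum_nonneg) auto
    hence "real g * (\<Sum>a\<in>{1..N}. if g dvd a then 1 / real a else 0)\<^sup>2 \<le> real g * (harm N / real g)\<^sup>2"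
      by (rule mult_left_mono) simp
    also have "\<dots> = 1 / real g * (harm N)\<^sup>2" using g by (simp add: power2_eq_square)
    finally show "real g * (\<Sum>a\<in>{1..N}. if g dvd a then 1 / real a else 0)\<^sup>2 \<le> 1 / real g * (harm N)\<^sup>2" .
  qed
  also have "\<dots> = (\<Sum>g\<in>{1..N}. 1 / real g) * (harm N)\<^sup>2" by (simp only: sum_distrib_right)
  also have "\<dots> = (harm N) ^ 3"
    by (simp add: harm_def inverse_eq_divide power3_eq_cube power2_eq_square)
  finally show ?thesis .
qed

text \<open>For fixed \<open>h\<close> and \<open>e = gcd h q\<close>, the residues of
  \<open>h * t\<^sup>2\<close> are nonzero multiples of \<open>e\<close>, each taken at most
  \<open>2 * e\<close> times the number of divisors of \<open>q\<close>, while the weights of these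
  multiples sum to at most \<open>2 / e * harm q\<close>. So \<open>e\<close> cancels and the bound
  is uniform in \<open>h\<close>.\<close>

lemma sum_recip_sym_unit_squares_le:
  assumes q: "q > 0"
  shows "(\<Sum>t | t < q \<and> coprime t q. \<Sum>h\<in>{1..<q}. recip_sym q h * recip_sym q (h * t\<^sup>2 mod q))
           \<le> 8 * real (card {d. d dvd q}) * (harm q)\<^sup>2"
proof -
  define U where "U = {t. t < q \<and> coprime t q}"
  define \<tau> where "\<tau> = card {d. d dvd q}"
  have finU: "finite U" unfolding U_def by auto
  have H0: "harm q \<ge> (0::real)" by (rule harm_nonneg)
  have inner: "(\<Sum>t\<in>U. recip_sym q (h * t\<^sup>2 mod q)) \<le> 4 * real \<tau> * harm q" if h: "h \<in> {1..<q}" for h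
  proof -
    define e where "e = gcd h q"
    have e: "e dvd q" "e > 0" "e dvd h" using q by (auto simp: e_def)
    define K where "K = {k. k \<in> {1..<q} \<and> e dvd k}"
    have finK: "finite K" unfolding K_def by auto
    have maps: "(\<lambda>t. h * t\<^sup>2 mod q) ` U \<subseteq> K"
    proof (rule image_subsetI)
      fix t assume t: "t \<in> U"
      have "\<not> q dvd h * t\<^sup>2"
      proof
        assume "q dvd h * t\<^sup>2"
        moreover have "coprime q (t\<^sup>2)" using t unfolding U_def by (simp add: coprime_commute)
        ultimately have "q dvd h" using coprime_dvd_mult_left_iff by blast
        thus False using h by (auto dest: dvd_imp_le)
      qed
      hence "h * t\<^sup>2 mod q > 0" by (simp add: mod_greater_zero_iff_not_dvd)
      moreover have "e dvd h * t\<^sup>2 mod q" using e by (simp add: dvd_mod)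
      ultimately show "h * t\<^sup>2 mod q \<in> K" using q unfolding K_def by auto
    qed
    have "(\<Sum>t\<in>U. recip_sym q (h * t\<^sup>2 mod q))
            = (\<Sum>k\<in>K. \<Sum>t\<in>{t\<in>U. h * t\<^sup>2 mod q = k}. recip_sym q (h * t\<^sup>2 mod q))"
      by (rule sum.group[OF finU finK maps, symmetric])
    also have "\<dots> = (\<Sum>k\<in>K. real (card {t\<in>U. h * t\<^sup>2 mod q = k}) * recip_sym q k)"
      by (intro sum.cong) auto
    also have "\<dots> \<le> (\<Sum>k\<in>K. real (2 * e * \<tau>) * recip_sym q k)"
    proof (intro sum_mono mult_right_mono recip_sym_nonneg of_nat_mono)
      fix k assume k: "k \<in> K"
      hence "{t\<in>U. h * t\<^sup>2 mod q = k} = {t. t < q \<and> coprime t q \<and> [h * t\<^sup>2 = k] (mod q)}"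
        unfolding U_def K_def cong_def by auto
      thus "card {t\<in>U. h * t\<^sup>2 mod q = k} \<le> 2 * e * \<tau>"
        using card_square_ratio_le[OF q, of h k] unfolding e_def \<tau>_def by simp
    qed
    also have "\<dots> = real (2 * e * \<tau>) * (\<Sum>k\<in>K. recip_sym q k)" by (simp add: sum_distrib_left)
    also have "\<dots> \<le> real (2 * e * \<tau>) * (2 / real e * harm q)"
      using sum_recip_sym_multiples_le[OF e(1,2)] unfolding K_def by (intro mult_left_mono) auto
    also have "\<dots> = 4 * real \<tau> * harm q" using e(2) by simp
    finally show ?thesis .
  qed
  have "(\<Sum>t\<in>U. \<Sum>h\<in>{1..<q}. recip_sym q h * recip_sym q (h * t\<^sup>2 mod q))
          = (\<Sum>h\<in>{1..<q}. recip_sym q h * (\<Sum>t\<in>U. recip_sym q (h * t\<^sup>2 mod q)))"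
    by (subst sum.swap) (simp add: sum_distrib_left)
  also have "\<dots> \<le> (\<Sum>h\<in>{1..<q}. recip_sym q h * (4 * real \<tau> * harm q))"
    by (intro sum_mono mult_left_mono inner recip_sym_nonneg)
  \<comment> \<open>Reading the range as the multiples of 1 makes the bound for multiples applicable
    with \<open>e = 1\<close>.\<close>
  also have "\<dots> = (\<Sum>h | h \<in> {1..<q} \<and> 1 dvd h. recip_sym q h) * (4 * real \<tau> * harm q)"
  proof -
    have "{h. h \<in> {1..<q} \<and> 1 dvd h} = {1..<q}" by auto
    thus ?thesis by (simp only: sum_distrib_right)
  qed
  also have "\<dots> \<le> (2 / real 1 * harm q) * (4 * real \<tau> * harm q)"
    by (intro mult_right_mono sum_recip_sym_multiples_le) (use H0 in auto)
  also have "\<dots> = 8 * real \<tau> * (harm q)\<^sup>2" by (simp add: power2_eq_square)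
  finally show ?thesis unfolding U_def \<tau>_def .
qed

text \<open>Substituting \<open>h * b\<^sup>2\<close> for the frequency \<open>h\<close>, the inner sum depends only on \<open>a / b\<close> modulo \<open>q\<close>.\<close>

lemma sum_recip_sym_pairs_le:
  fixes Z :: "(nat \<times> nat) set" and N :: real
  assumes q: "q > 0" and fin: "finite Z"
    and Z: "\<And>a b. (a, b) \<in> Z \<Longrightarrow> coprime a q \<and> coprime b q"
    and N: "\<And>t. real (card {(a, b). (a, b) \<in> Z \<and> [a = t * b] (mod q)}) \<le> N"
  shows "(\<Sum>(a, b)\<in>Z. \<Sum>h\<in>{1..<q}. recip_sym q (h * a\<^sup>2 mod q) * recip_sym q (h * b\<^sup>2 mod q))
           \<le> N * (8 * real (card {d. d dvd q}) * (harm q)\<^sup>2)"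
proof -
  define U where "U = {t. t < q \<and> coprime t q}"
  have finU: "finite U" unfolding U_def by auto
  define K where "K = (\<lambda>t. \<Sum>h\<in>{1..<q}. recip_sym q h * recip_sym q (h * t\<^sup>2 mod q))"
  have K0: "K t \<ge> 0" for t unfolding K_def by (intro sum_nonneg mult_nonneg_nonneg recip_sym_nonneg)
  have "\<exists>t\<in>U. [fst z = t * snd z] (mod q)" if z: "z \<in> Z" for z
  proof -
    obtain a b where ab: "z = (a, b)" by (cases z)
    have cop: "coprime a q" "coprime b q" using Z z ab by auto
    \<comment> \<open>\<open>x\<close> inverts \<open>b\<close>, so the residue of
      \<open>a * x\<close> is the unit \<open>a / b\<close>.\<close>
    obtain x where x: "[b * x = 1] (mod q)" using cong_solve_coprime_nat[OF cop(2)] by auto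
    have "coprime (b * x) q" using x by (metis cong_imp_coprime cong_sym coprime_1_left)
    hence "coprime (a * x) q" using cop by simp
    hence "coprime (a * x mod q) q" using q by (simp add: coprime_mod_left_iff)
    hence "a * x mod q \<in> U" using q unfolding U_def by simp
    moreover have "[a * x mod q * b = a * (b * x)] (mod q)"
      by (simp add: cong_def mod_mult_left_eq) (simp add: mult_ac)
    hence "[a * x mod q * b = a * 1] (mod q)" using cong_scalar_left[OF x, of a] by (rule cong_trans)
    hence "[a = a * x mod q * b] (mod q)" by (simp add: cong_sym_eq)
    ultimately show ?thesis unfolding ab fst_conv snd_conv by blast
  qed
  hence "\<forall>z\<in>Z. \<exists>t. t \<in> U \<and> [fst z = t * snd z] (mod q)" by blast
  from bchoice[OF this] obtain T
    where T: "\<And>z. z \<in> Z \<Longrightarrow> T z \<in> U" "\<And>z. z \<in> Z \<Longrightarrow> [fst z = T z * snd z] (mod q)"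
    by blast
  have eqK: "(\<Sum>h\<in>{1..<q}. recip_sym q (h * a\<^sup>2 mod q) * recip_sym q (h * b\<^sup>2 mod q)) = K (T (a, b))"
    if z: "(a, b) \<in> Z" for a b
  proof -
    define t where "t = T (a, b)"
    have ab: "[a = t * b] (mod q)" using T(2)[OF z] by (simp add: t_def)
    have cop: "coprime (b\<^sup>2) q" using Z[OF z] by simp
    define f where "f = (\<lambda>h. h * b\<^sup>2 mod q)"
    have "inj_on f {1..<q}"
    proof (rule inj_onI)
      fix g h assume gh: "g \<in> {1..<q}" "h \<in> {1..<q}" "f g = f h"
      hence "[g * b\<^sup>2 = h * b\<^sup>2] (mod q)" by (simp add: f_def cong_def)
      hence "[g = h] (mod q)" using cop by (simp add: cong_mult_rcancel_nat)
      thus "g = h" using gh by (simp add: cong_def)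
    qed
    moreover have "f ` {1..<q} \<subseteq> {1..<q}"
    proof (rule image_subsetI)
      fix h assume h: "h \<in> {1..<q}"
      have "\<not> q dvd h * b\<^sup>2"
      proof
        assume "q dvd h * b\<^sup>2"
        hence "q dvd h" using cop coprime_dvd_mult_left_iff coprime_commute by blast
        thus False using h by (auto dest: dvd_imp_le)
      qed
      hence "h * b\<^sup>2 mod q > 0" by (simp add: mod_greater_zero_iff_not_dvd)
      thus "f h \<in> {1..<q}" using q by (simp add: f_def Suc_leI)
    qed
    ultimately have bij: "bij_betw f {1..<q} {1..<q}"
      by (simp add: bij_betw_def endo_inj_surj)
    have "h * a\<^sup>2 mod q = f h * t\<^sup>2 mod q" for h
    proof -
      have "[h * a\<^sup>2 = h * (t * b)\<^sup>2] (mod q)" using ab by (intro cong_mult cong_pow cong_refl)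
      hence "h * a\<^sup>2 mod q = h * b\<^sup>2 * t\<^sup>2 mod q" by (simp add: cong_def power_mult_distrib mult_ac)
      thus ?thesis by (simp add: f_def mod_mult_left_eq)
    qed
    hence "(\<Sum>h\<in>{1..<q}. recip_sym q (h * a\<^sup>2 mod q) * recip_sym q (h * b\<^sup>2 mod q))
             = (\<Sum>h\<in>{1..<q}. recip_sym q (f h * t\<^sup>2 mod q) * recip_sym q (f h))"
      by (simp add: f_def)
    also have "\<dots> = (\<Sum>h\<in>{1..<q}. recip_sym q (h * t\<^sup>2 mod q) * recip_sym q h)"
      by (rule sum.reindex_bij_betw[OF bij])
    finally show ?thesis by (simp add: K_def t_def mult.commute)
  qed
  have "(\<Sum>(a, b)\<in>Z. \<Sum>h\<in>{1..<q}. recip_sym q (h * a\<^sup>2 mod q) * recip_sym q (h * b\<^sup>2 mod q)) = (\<Sum>z\<in>Z. K (T z))"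
    using eqK by (intro sum.cong) auto
  also have "\<dots> = (\<Sum>t\<in>U. \<Sum>z\<in>{z\<in>Z. T z = t}. K (T z))"
    by (rule sum.group[OF fin finU, symmetric]) (use T in auto)
  also have "\<dots> = (\<Sum>t\<in>U. real (card {z\<in>Z. T z = t}) * K t)" by simp
  also have "\<dots> \<le> (\<Sum>t\<in>U. N * K t)"
  proof (intro sum_mono mult_right_mono K0)
    fix t
    have "{z\<in>Z. T z = t} \<subseteq> {(a, b). (a, b) \<in> Z \<and> [a = t * b] (mod q)}" using T(2) by auto
    moreover have "finite {(a, b). (a, b) \<in> Z \<and> [a = t * b] (mod q)}" by (rule finite_subset[OF _ fin]) auto
    ultimately have "card {z\<in>Z. T z = t} \<le> card {(a, b). (a, b) \<in> Z \<and> [a = t * b] (mod q)}"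
      by (intro card_mono)
    thus "real (card {z\<in>Z. T z = t}) \<le> N" using N[of t] by linarith
  qed
  also have "\<dots> = N * (\<Sum>t\<in>U. K t)" by (simp add: sum_distrib_left)
  also have "\<dots> \<le> N * (8 * real (card {d. d dvd q}) * (harm q)\<^sup>2)"
  proof (rule mult_left_mono)
    show "(\<Sum>t\<in>U. K t) \<le> 8 * real (card {d. d dvd q}) * (harm q)\<^sup>2"
      using sum_recip_sym_unit_squares_le[OF q] unfolding U_def K_def .
    show "N \<ge> 0" using N[of 0] by (meson of_nat_0_le_iff order_trans)
  qed
  finally show ?thesis .
qed

text \<open>Dividing by \<open>g = gcd a b\<close>, a unit modulo \<open>q\<close>, gives a
  primitive solution in a box of side \<open>D div g\<close>. Summing
  \<open>2 * (1 + (D / g)\<^sup>2 / q)\<close> over \<open>g \<le> G\<close>, the constant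
  accumulates to \<open>2 * G\<close>, which is why the gcd is capped, while the other term
  converges.\<close>

lemma card_pairs_gcd_le_cong:
  fixes D G q t :: nat
  assumes q: "q > 0"
  shows "real (card {(a, b). (a \<in> {1..D} \<and> b \<in> {1..D} \<and> coprime a q \<and> coprime b q \<and> gcd a b \<le> G) \<and> [a = t * b] (mod q)})
           \<le> 2 * (real G + 2 * (real D)\<^sup>2 / real q)"
proof -
  define L where "L = {(a, b). (a \<in> {1..D} \<and> b \<in> {1..D} \<and> coprime a q \<and> coprime b q \<and> gcd a b \<le> G) \<and> [a = t * b] (mod q)}"
  define R where "R = (\<lambda>g. {(a, b). a \<in> {1..D div g} \<and> b \<in> {1..D div g} \<and> coprime a b \<and> [a = t * b] (mod q)})"
  have finR: "finite (R g)" for g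
    by (rule finite_subset[of _ "{1..D div g} \<times> {1..D div g}"]) (auto simp: R_def)
  have "L \<subseteq> (\<Union>g\<in>{1..G}. (\<lambda>(a, b). (g * a, g * b)) ` R g)"
  proof
    fix z assume z: "z \<in> L"
    obtain a b where ab: "z = (a, b)" by (cases z)
    hence h: "a \<in> {1..D}" "b \<in> {1..D}" "coprime a q" "coprime b q" "gcd a b \<le> G" "[a = t * b] (mod q)"
      using z unfolding L_def by auto
    define g where "g = gcd a b"
    have g0: "g > 0" using h(1) by (simp add: g_def)
    define a' where "a' = a div g"
    define b' where "b' = b div g"
    have ab': "a = g * a'" "b = g * b'" by (simp_all add: a'_def b'_def g_def)
    have cop: "coprime a' b'" using h(1) unfolding a'_def b'_def g_def by (intro div_gcd_coprime) auto
    have "a' \<noteq> 0" using h(1) ab'(1) by (cases "a' = 0") auto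
    moreover have "b' \<noteq> 0" using h(2) ab'(2) by (cases "b' = 0") auto
    ultimately have "a' \<ge> 1" "b' \<ge> 1" by auto
    moreover have "a' \<le> D div g" "b' \<le> D div g"
      using h(1,2) by (auto simp: a'_def b'_def div_le_mono)
    moreover have "[a' = t * b'] (mod q)"
    proof -
      have "coprime g q" using h(3) ab' by simp
      moreover have "[g * a' = g * (t * b')] (mod q)" using h(6) ab' by (simp add: mult_ac)
      ultimately show ?thesis by (simp add: cong_mult_lcancel_nat)
    qed
    ultimately have "(a', b') \<in> R g" using cop unfolding R_def by auto
    hence "z \<in> (\<lambda>(a, b). (g * a, g * b)) ` R g" using ab ab' by force
    moreover have "g \<in> {1..G}" using g0 h(5) by (simp add: g_def Suc_leI)
    ultimately show "z \<in> (\<Union>g\<in>{1..G}. (\<lambda>(a, b). (g * a, g * b)) ` R g)" by blast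
  qed
  hence "card L \<le> card (\<Union>g\<in>{1..G}. (\<lambda>(a, b). (g * a, g * b)) ` R g)"
    using finR by (intro card_mono) auto
  also have "\<dots> \<le> (\<Sum>g\<in>{1..G}. card ((\<lambda>(a, b). (g * a, g * b)) ` R g))"
    by (rule card_UN_le) simp
  also have "\<dots> \<le> (\<Sum>g\<in>{1..G}. card (R g))" by (intro sum_mono card_image_le finR)
  finally have "real (card L) \<le> (\<Sum>g\<in>{1..G}. real (card (R g)))"
    unfolding of_nat_sum[symmetric] by (rule of_nat_mono)
  also have "\<dots> \<le> (\<Sum>g\<in>{1..G}. 2 + 2 * (real D)\<^sup>2 / real q * (1 / (real g)\<^sup>2))"
  proof (rule sum_mono)
    fix g assume g: "g \<in> {1..G}"
    have "real (card (R g)) \<le> 2 * (1 + (real (D div g))\<^sup>2 / real q)"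
      unfolding R_def by (rule card_coprime_pairs_cong_le[OF q])
    also have "(real (D div g))\<^sup>2 \<le> (real D / real g)\<^sup>2" by (intro power_mono of_nat_div_le_of_nat) auto
    finally show "real (card (R g)) \<le> 2 + 2 * (real D)\<^sup>2 / real q * (1 / (real g)\<^sup>2)"
      using q by (simp add: divide_right_mono power_divide field_simps)
  qed
  also have "\<dots> = 2 * real G + 2 * (real D)\<^sup>2 / real q * (\<Sum>g\<in>{1..G}. 1 / (real g)\<^sup>2)"
    by (simp add: sum.distrib sum_distrib_left)
  also have "(\<Sum>g\<in>{1..G}. 1 / (real g)\<^sup>2) \<le> 2"
  proof -
    have "(\<Sum>g\<in>{1..G}. 1 / (real g)\<^sup>2) \<le> (\<Sum>g\<in>insert 1 {2..G}. 1 / (real g)\<^sup>2)"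
      by (intro sum_mono2) auto
    also have "\<dots> = 1 + (\<Sum>g\<in>{2..G}. 1 / (real g)\<^sup>2)" by simp
    also have "(\<Sum>g\<in>{2..G}. 1 / (real g)\<^sup>2) \<le> 1 / real 1" by (rule sum_inverse_squares_le) auto
    finally show ?thesis by simp
  qed
  finally show ?thesis unfolding L_def[symmetric] by (simp add: mult_left_mono divide_right_mono)
qed

section \<open>Fourier analysis modulo q\<close>

text \<open>The sine bound in the shape of the weight: with \<open>v = k / q\<close>,
  \<open>1 / (v * (1 - v))\<close> is \<open>q * recip_sym q k\<close>.\<close>

lemma sin_pi_mult_ge:
  fixes v :: real
  assumes "0 \<le> v" "v \<le> 1"
  shows "v * (1 - v) \<le> sin (pi * v)"
proof -
  \<comment> \<open>While \<open>pi * v \<le> 1 < pi / 3\<close>, the derivative of sine is at least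
    1/2, and \<open>pi / 2 > 1\<close>. Beyond that, \<open>sin (pi * v)\<close> is at least
    \<open>sin (pi / 6) = 1/2\<close>, hence at least \<open>v\<close>.\<close>
  have half: "v \<le> sin (pi * v)" if v: "0 \<le> v" "v \<le> 1/2" for v :: real
  proof (cases "pi * v \<le> 1")
    case True
    define s where "s = pi * v"
    have s: "0 \<le> s" "s \<le> 1" using v True by (auto simp: s_def)
    have "sin 0 - 0 / 2 \<le> sin s - s / 2"
    proof (rule DERIV_nonneg_imp_nondecreasing[OF s(1)])
      fix x assume x: "0 \<le> x" "x \<le> s"
      have "cos (pi / 3) \<le> cos x"
        using x s pi_gt3 by (intro cos_monotone_0_pi_le) auto
      hence "0 \<le> cos x - 1 / 2" by (simp add: cos_60)
      moreover have "((\<lambda>x. sin x - x / 2) has_real_derivative cos x - 1 / 2) (at x)"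
        by (auto intro!: derivative_eq_intros)
      ultimately show "\<exists>y. ((\<lambda>x. sin x - x / 2) has_real_derivative y) (at x) \<and> 0 \<le> y" by blast
    qed
    hence "s / 2 \<le> sin s" by simp
    moreover have "3 * v \<le> pi * v" using v pi_gt3 by (intro mult_right_mono) auto
    hence "v \<le> s / 2" using v by (simp add: s_def)
    ultimately show ?thesis by (simp add: s_def)
  next
    case False
    have "pi / 6 \<le> pi * v" using False pi_less_4 by linarith
    moreover have "pi * v \<le> pi * (1 / 2)" using v by (intro mult_left_mono) auto
    ultimately have "sin (pi / 6) \<le> sin (pi * v)"
      using pi_gt3 by (intro sin_monotone_2pi_le) auto
    thus ?thesis using v by (simp add: sin_30)
  qed
  show ?thesis
  proof (cases "v \<le> 1/2")
    case True
    have "v * (1 - v) \<le> v * 1" using assms by (intro mult_left_mono) auto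
    thus ?thesis using half[of v] True assms by simp
  next
    case False
    have "v * (1 - v) \<le> 1 * (1 - v)" using assms by (intro mult_right_mono) auto
    also have "\<dots> \<le> sin (pi * (1 - v))" using half[of "1 - v"] False assms by simp
    also have "\<dots> = sin (pi * v)" by (simp add: right_diff_distrib)
    finally show ?thesis .
  qed
qed

definition exp_frac :: "nat \<Rightarrow> int \<Rightarrow> complex" where
  "exp_frac q n = cis (2 * pi * real_of_int n / real q)"

lemma exp_frac_add: "exp_frac q (m + n) = exp_frac q m * exp_frac q n"
  by (simp add: exp_frac_def cis_mult ring_distribs add_divide_distrib)

lemma exp_frac_minus: "exp_frac q (- n) = cnj (exp_frac q n)"
  by (simp add: exp_frac_def cis_cnj)

lemma exp_frac_0 [simp]: "exp_frac q 0 = 1"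
  by (simp add: exp_frac_def)

lemma norm_exp_frac [simp]: "norm (exp_frac q n) = 1"
  by (simp add: exp_frac_def)

lemma exp_frac_power: "exp_frac q n ^ m = exp_frac q (int m * n)"
  unfolding exp_frac_def Complex.DeMoivre by (simp add: mult_ac)

lemma exp_frac_cong:
  assumes "q > 0" "[m = n] (mod int q)"
  shows "exp_frac q m = exp_frac q n"
proof -
  obtain k where k: "m - n = int q * k" using assms(2) by (auto simp: cong_iff_dvd_diff)
  have "2 * pi * real_of_int (int q * k) / real q = 2 * pi * real_of_int k" using assms(1) by simp
  hence "exp_frac q (m - n) = 1"
    unfolding exp_frac_def k by (simp only: cis_multiple_2pi Ints_of_int)
  thus ?thesis using exp_frac_add[of q "m - n" n] by simp
qed

lemma norm_one_minus_exp_frac: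
  "norm (1 - exp_frac q n) = 2 * \<bar>sin (pi * (real_of_int n / real q))\<bar>"
proof -
  define t where "t = pi * (real_of_int n / real q)"
  have "exp_frac q n = cis (2 * t)" by (simp add: exp_frac_def t_def mult.assoc)
  hence "(norm (1 - exp_frac q n))\<^sup>2 = (1 - cos (2 * t))\<^sup>2 + (sin (2 * t))\<^sup>2"
    by (simp add: cmod_power2)
  also have "\<dots> = 2 - 2 * cos (2 * t)"
    using sin_cos_squared_add[of "2 * t"] by (simp add: power2_eq_square algebra_simps)
  also have "\<dots> = (2 * \<bar>sin t\<bar>)\<^sup>2"
    by (simp add: cos_double_sin power_mult_distrib)
  finally have "(norm (1 - exp_frac q n))\<^sup>2 = (2 * \<bar>sin t\<bar>)\<^sup>2" .
  thus ?thesis unfolding t_def by (rule power2_eq_imp_eq) auto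
qed

lemma exp_frac_eq_1_iff:
  assumes "q > 0"
  shows "exp_frac q n = 1 \<longleftrightarrow> int q dvd n"
proof
  assume "int q dvd n"
  hence "[n = 0] (mod int q)" by (simp add: cong_0_iff)
  thus "exp_frac q n = 1" using exp_frac_cong[OF assms] by fastforce
next
  assume "exp_frac q n = 1"
  hence "sin (pi * (real_of_int n / real q)) = 0" using norm_one_minus_exp_frac[of q n] by simp
  then obtain i where "pi * (real_of_int n / real q) = of_int i * pi"
    using sin_zero_iff_int2 by blast
  hence "pi * (real_of_int n / real q) = pi * of_int i" by (simp only: mult.commute)
  hence "real_of_int n / real q = of_int i" by (subst (asm) mult_left_cancel) simp_all
  hence "real_of_int n = of_int i * real q" using assms by (simp add: field_simps)
  hence "n = i * int q" by (metis of_int_eq_iff of_int_mult of_int_of_nat_eq)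
  thus "int q dvd n" by simp
qed

lemma sum_exp_frac:
  assumes q: "q > 0"
  shows "(\<Sum>h<q. exp_frac q (int h * n)) = (if int q dvd n then of_nat q else 0)"
proof (cases "int q dvd n")
  case True
  have "exp_frac q (int h * n) = 1" for h
    using True exp_frac_eq_1_iff[OF q] by simp
  thus ?thesis using True by simp
next
  case False
  hence ne: "exp_frac q n \<noteq> 1" using exp_frac_eq_1_iff[OF q] by simp
  have "exp_frac q n ^ q = 1" unfolding exp_frac_power using exp_frac_eq_1_iff[OF q] by simp
  hence "(\<Sum>h<q. exp_frac q n ^ h) = 0" using geometric_sum[OF ne, of q] by simp
  thus ?thesis using False by (simp add: exp_frac_power)
qed

text \<open>Geometric series: the numerator is at most 2 and the denominator is
  \<open>2 * sin (pi * v)\<close>. The bound is free of \<open>M\<close>, which makes the covariance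
  bound independent of the lengths of the counts.\<close>

lemma norm_sum_exp_frac_le:
  assumes q: "q > 0" and nd: "\<not> q dvd n"
  shows "norm (\<Sum>m\<in>{1..M}. exp_frac q (int n * int m)) \<le> real q * recip_sym q (n mod q)"
proof -
  define j where "j = n mod q"
  have j: "0 < j" "j < q" using q nd by (auto simp: j_def mod_greater_zero_iff_not_dvd)
  define v where "v = real j / real q"
  have v: "0 < v" "v < 1" using j by (auto simp: v_def)
  define z where "z = exp_frac q (int j)"
  have "[int n = int j] (mod int q)" by (simp add: j_def cong_def zmod_int)
  hence z: "z = exp_frac q (int n)" unfolding z_def using exp_frac_cong[OF q] by metis
  have norm1: "norm (1 - z) = 2 * sin (pi * v)"
  proof -
    have "pi * v \<le> pi * 1" using v by (intro mult_left_mono) auto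
    hence "sin (pi * v) \<ge> 0" using v by (intro sin_ge_zero) auto
    thus ?thesis using norm_one_minus_exp_frac[of q "int j"] by (simp add: z_def v_def)
  qed
  have vv: "v * (1 - v) > 0" using v by simp
  have sin_ge: "v * (1 - v) \<le> sin (pi * v)" using v by (intro sin_pi_mult_ge) auto
  have "z \<noteq> 1" using norm1 vv sin_ge by auto
  have "(\<Sum>m\<in>{1..M}. exp_frac q (int n * int m)) = (\<Sum>m\<in>{1..M}. z ^ m)"
    by (simp add: z exp_frac_power mult.commute)
  also have "\<dots> = z * (\<Sum>m<M. z ^ m)"
    by (induction M) (simp_all add: algebra_simps)
  also have "norm \<dots> = norm (\<Sum>m<M. z ^ m)" by (simp add: norm_mult z)
  also have "\<dots> = norm (z ^ M - 1) / norm (z - 1)"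
    using geometric_sum[OF \<open>z \<noteq> 1\<close>, of M] by (simp add: norm_divide)
  also have "\<dots> \<le> 2 / (2 * sin (pi * v))"
  proof -
    have "norm (z ^ M - 1) \<le> norm (z ^ M) + norm (1::complex)" by (rule norm_triangle_ineq4)
    hence "norm (z ^ M - 1) \<le> 2" by (simp add: norm_power z)
    thus ?thesis using norm1 vv sin_ge by (intro frac_le) (auto simp: norm_minus_commute)
  qed
  also have "\<dots> \<le> 1 / (v * (1 - v))" using vv sin_ge by (simp add: frac_le)
  also have "\<dots> = real q * recip_sym q j"
    using j by (simp add: v_def recip_sym_def of_nat_diff field_simps)
  finally show ?thesis by (simp add: j_def)
qed

section \<open>Counts in residue classes and their covariances\<close>

text \<open>With \<open>k = d\<^sup>2\<close> and \<open>M\<close> the integer part of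
  \<open>x / d\<^sup>2\<close>, this counts the multiples of \<open>d\<^sup>2\<close> up to
  \<open>x\<close> in the class of \<open>a\<close>.\<close>

definition progression_count :: "nat \<Rightarrow> nat \<Rightarrow> nat \<Rightarrow> nat \<Rightarrow> nat" where
  "progression_count q k M a = card {m \<in> {1..M}. [k * m = a] (mod q)}"

lemma progression_count_eq_sum:
  "real (progression_count q k M a) = (\<Sum>m\<in>{1..M}. if [k * m = a] (mod q) then 1 else 0)"
  unfolding progression_count_def by (simp flip: sum.inter_filter)

lemma sum_residues_cong:
  fixes f :: "nat \<Rightarrow> real"
  assumes q: "q > 0" and f: "\<And>a. [n = a] (mod q) \<Longrightarrow> f a = c"
  shows "(\<Sum>a\<in>{1..q}. if [n = a] (mod q) then f a else 0) = c"
proof -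
  \<comment> \<open>In \<open>{1..q}\<close>, the range that contains \<open>totatives q\<close>,
    the zero class is represented by \<open>q\<close>.\<close>
  define r where "r = (if n mod q = 0 then q else n mod q)"
  have r: "r \<in> {1..q}" using q by (auto simp: r_def)
  have iff: "[n = a] (mod q) \<longleftrightarrow> a = r" if "a \<in> {1..q}" for a
  proof -
    have "n mod q \<noteq> q" using mod_less_divisor[of q n] q by linarith
    thus ?thesis using that q by (cases "a = q") (auto simp: r_def cong_def)
  qed
  have "(\<Sum>a\<in>{1..q}. if [n = a] (mod q) then f a else 0) = (\<Sum>a\<in>{1..q}. if a = r then c else 0)"
    using iff f by (intro sum.cong) auto
  thus ?thesis using r by simp
qed

lemma sum_progression_count:
  assumes q: "q > 0"
  shows "(\<Sum>a\<in>{1..q}. real (progression_count q k M a)) = real M"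
proof -
  have "(\<Sum>a\<in>{1..q}. real (progression_count q k M a))
          = (\<Sum>m\<in>{1..M}. \<Sum>a\<in>{1..q}. if [k * m = a] (mod q) then 1 else 0)"
    unfolding progression_count_eq_sum by (rule sum.swap)
  also have "\<dots> = (\<Sum>m\<in>{1..M}. 1)" by (intro sum.cong refl sum_residues_cong[OF q])
  finally show ?thesis by simp
qed

text \<open>This is \<open>q\<close> times the covariance of two counts at a uniformly random
  residue. Over all residues the means are exactly \<open>M / q\<close> and
  \<open>N / q\<close>.\<close>

definition progression_cov :: "nat \<Rightarrow> nat \<Rightarrow> nat \<Rightarrow> nat \<Rightarrow> nat \<Rightarrow> real" where
  "progression_cov q k M l N = (\<Sum>a\<in>{1..q}. (real (progression_count q k M a) - real M / real q)
                                   * (real (progression_count q l N a) - real N / real q))"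

lemma progression_cov_eq:
  assumes q: "q > 0"
  shows "progression_cov q k M l N =
    (\<Sum>a\<in>{1..q}. real (progression_count q k M a) * real (progression_count q l N a)) - real M * real N / real q"
proof -
  have "progression_cov q k M l N =
      (\<Sum>a\<in>{1..q}. real (progression_count q k M a) * real (progression_count q l N a))
       - real M / real q * (\<Sum>a\<in>{1..q}. real (progression_count q l N a))
       - real N / real q * (\<Sum>a\<in>{1..q}. real (progression_count q k M a))
       + (\<Sum>a\<in>{1..q}. real M / real q * (real N / real q))"
  proof -
    have "progression_cov q k M l N = (\<Sum>a\<in>{1..q}. real (progression_count q k M a) * real (progression_count q l N a)
        - real M / real q * real (progression_count q l N a)
        - real N / real q * real (progression_count q k M a) + real M / real q * (real N / real q))"
      unfolding progression_cov_def by (intro sum.cong refl) (simp only: left_diff_distrib right_diff_distrib, simp)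
    thus ?thesis by (simp only: sum.distrib sum_subtractf sum_distrib_left)
  qed
  moreover have "(\<Sum>a\<in>{1..q}. real M / real q * (real N / real q)) = real M * real N / real q"
    using q by simp
  ultimately show ?thesis unfolding sum_progression_count[OF q] by (simp add: mult.commute)
qed

lemma sum_progression_count_mult:
  assumes q: "q > 0"
  shows "(\<Sum>a\<in>{1..q}. real (progression_count q k M a) * real (progression_count q l N a))
     = (\<Sum>m\<in>{1..M}. \<Sum>n\<in>{1..N}. if [k * m = l * n] (mod q) then 1 else 0)"
proof -
  have "(\<Sum>a\<in>{1..q}. real (progression_count q k M a) * real (progression_count q l N a))
     = (\<Sum>a\<in>{1..q}. \<Sum>m\<in>{1..M}. \<Sum>n\<in>{1..N}. if [k * m = a] (mod q) then (if [l * n = a] (mod q) then 1 else 0) else 0)"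
    unfolding progression_count_eq_sum sum_product by (intro sum.cong refl) simp
  also have "\<dots> = (\<Sum>m\<in>{1..M}. \<Sum>n\<in>{1..N}. \<Sum>a\<in>{1..q}. if [k * m = a] (mod q) then (if [l * n = a] (mod q) then 1 else 0) else 0)"
    by (subst sum.swap) (intro sum.cong refl sum.swap)
  also have "\<dots> = (\<Sum>m\<in>{1..M}. \<Sum>n\<in>{1..N}. if [k * m = l * n] (mod q) then 1 else 0)"
    by (intro sum.cong refl sum_residues_cong[OF q]) (auto simp: cong_def)
  finally show ?thesis .
qed

text \<open>When additive characters detect \<open>[k * m = l * n] (mod q)\<close>, the frequency 0
  gives \<open>M * N\<close>, which cancels the product of the means. Every other frequency gives a
  product of two geometric sums with ratio different from 1, because \<open>k\<close> and
  \<open>l\<close> are units.\<close>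

lemma progression_cov_fourier:
  assumes q: "q > 0" and k: "coprime k q" and l: "coprime l q"
  shows "\<bar>progression_cov q k M l N\<bar> \<le> real q * (\<Sum>h\<in>{1..<q}. recip_sym q (h * k mod q) * recip_sym q (h * l mod q))"
proof -
  define F where "F = (\<lambda>k M h. \<Sum>m\<in>{1..M}. exp_frac q (int (h * k) * int m))"
  have orth: "of_nat q * (if [k * m = l * n] (mod q) then 1 else 0)
               = (\<Sum>h<q. exp_frac q (int (h * k) * int m) * cnj (exp_frac q (int (h * l) * int n)))" for m n
  proof -
    have "[k * m = l * n] (mod q) \<longleftrightarrow> int q dvd int k * int m - int l * int n"
      by (simp add: cong_iff_dvd_diff flip: cong_int_iff)
    hence "of_nat q * (if [k * m = l * n] (mod q) then 1 else 0) = (\<Sum>h<q. exp_frac q (int h * (int k * int m - int l * int n)))"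
      by (simp add: sum_exp_frac[OF q])
    also have "\<dots> = (\<Sum>h<q. exp_frac q (int (h * k) * int m) * cnj (exp_frac q (int (h * l) * int n)))"
      by (simp add: exp_frac_add[symmetric] exp_frac_minus[symmetric] algebra_simps)
    finally show ?thesis .
  qed
  have "of_nat q * complex_of_real (\<Sum>a\<in>{1..q}. real (progression_count q k M a) * real (progression_count q l N a))
     = (\<Sum>m\<in>{1..M}. \<Sum>n\<in>{1..N}. of_nat q * (if [k * m = l * n] (mod q) then 1 else 0))"
    unfolding sum_progression_count_mult[OF q] by (simp add: sum_distrib_left of_real_sum if_distrib cong: if_cong)
  also have "\<dots> = (\<Sum>m\<in>{1..M}. \<Sum>h<q. \<Sum>n\<in>{1..N}. exp_frac q (int (h * k) * int m) * cnj (exp_frac q (int (h * l) * int n)))"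
    unfolding orth by (intro sum.cong refl sum.swap)
  also have "\<dots> = (\<Sum>h<q. \<Sum>m\<in>{1..M}. \<Sum>n\<in>{1..N}. exp_frac q (int (h * k) * int m) * cnj (exp_frac q (int (h * l) * int n)))"
    by (rule sum.swap)
  also have "\<dots> = (\<Sum>h<q. F k M h * cnj (F l N h))"
    by (simp add: F_def sum_product)
  also have "{..<q} = insert 0 {1..<q}" using q by auto
  also have "(\<Sum>h\<in>insert 0 {1..<q}. F k M h * cnj (F l N h)) = of_nat M * of_nat N + (\<Sum>h\<in>{1..<q}. F k M h * cnj (F l N h))"
    by (simp add: F_def)
  finally have "of_nat q * complex_of_real (progression_cov q k M l N) = (\<Sum>h\<in>{1..<q}. F k M h * cnj (F l N h))"
    unfolding progression_cov_eq[OF q] using q by (simp add: algebra_simps)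
  hence "norm (of_nat q * complex_of_real (progression_cov q k M l N)) \<le> (\<Sum>h\<in>{1..<q}. norm (F k M h) * norm (F l N h))"
    using norm_sum[of "\<lambda>h. F k M h * cnj (F l N h)" "{1..<q}"] by (simp add: norm_mult)
  also have "\<dots> \<le> (\<Sum>h\<in>{1..<q}. (real q * recip_sym q (h * k mod q)) * (real q * recip_sym q (h * l mod q)))"
  proof (intro sum_mono mult_mono)
    fix h assume h: "h \<in> {1..<q}"
    have nd: "\<not> q dvd h * u" if "coprime u q" for u
    proof
      assume "q dvd h * u"
      hence "q dvd h" using that coprime_dvd_mult_left_iff coprime_commute by blast
      thus False using h by (auto dest: dvd_imp_le)
    qed
    show "norm (F k M h) \<le> real q * recip_sym q (h * k mod q)"
      unfolding F_def by (rule norm_sum_exp_frac_le[OF q nd[OF k]])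
    show "norm (F l N h) \<le> real q * recip_sym q (h * l mod q)"
      unfolding F_def by (rule norm_sum_exp_frac_le[OF q nd[OF l]])
  qed (auto intro!: mult_nonneg_nonneg recip_sym_nonneg)
  finally have "real q * \<bar>progression_cov q k M l N\<bar> \<le> real q * (real q * (\<Sum>h\<in>{1..<q}. recip_sym q (h * k mod q) * recip_sym q (h * l mod q)))"
    by (simp add: norm_mult sum_distrib_left mult_ac)
  thus ?thesis using q by simp
qed

text \<open>Up to length \<open>q\<close>, multiples of a unit hit each class at most once, so the
  counts are 0 or 1. Then the sum of products and the term subtracted from it both lie between 0 and
  \<open>min M N\<close>.\<close>

lemma progression_cov_trivial:
  assumes q: "q > 0" and k: "coprime k q" and l: "coprime l q" and M: "M \<le> q" and N: "N \<le> q"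
  shows "\<bar>progression_cov q k M l N\<bar> \<le> real (min M N)"
proof -
  have le1: "real (progression_count q k M a) \<le> 1" if k: "coprime k q" and M: "M \<le> q" for k M a
  proof -
    have "m = n" if "m \<in> {1..M}" "n \<in> {1..M}" "[k * m = a] (mod q)" "[k * n = a] (mod q)" for m n
    proof -
      have "[k * m = k * n] (mod q)" using that by (auto simp: cong_def)
      hence "[m = n] (mod q)" using k by (simp add: cong_mult_lcancel_nat)
      \<comment> \<open>\<open>q\<close> is the one value in the range that differs from its own
        remainder.\<close>
      thus "m = n" using that M by (cases "m = q"; cases "n = q") (auto simp: cong_def)
    qed
    hence "card {m \<in> {1..M}. [k * m = a] (mod q)} \<le> 1"
      by (subst card_le_Suc0_iff_eq[simplified One_nat_def[symmetric]]) auto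
    thus ?thesis by (simp add: progression_count_def)
  qed
  define I where "I = (\<Sum>a\<in>{1..q}. real (progression_count q k M a) * real (progression_count q l N a))"
  have "I \<le> (\<Sum>a\<in>{1..q}. real (progression_count q k M a) * 1)" "I \<le> (\<Sum>a\<in>{1..q}. 1 * real (progression_count q l N a))"
    unfolding I_def by (intro sum_mono mult_left_mono mult_right_mono le1 k l M N of_nat_0_le_iff)+
  hence "I \<le> real M" "I \<le> real N" using sum_progression_count[OF q] by simp_all
  moreover have "I \<ge> 0" unfolding I_def by (intro sum_nonneg) auto
  moreover have "real M * real N / real q \<le> real M"
    using mult_left_mono[of "real N" "real q" "real M"] N q by (simp add: divide_le_eq)
  moreover have "real M * real N / real q \<le> real N"
    using mult_right_mono[of "real M" "real q" "real N"] M q by (simp add: divide_le_eq mult.commute)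
  moreover have "0 \<le> real M * real N / real q" by simp
  moreover have "real (min M N) = min (real M) (real N)" by simp
  ultimately show ?thesis unfolding progression_cov_eq[OF q] I_def[symmetric] by linarith
qed

section \<open>The variance and the exceptional set\<close>

text \<open>Each pair satisfies one of the two bounds but is majorised by their sum, so the gcd term
  can be summed over all pairs at once. The factor 16 is 2 from the lattice count times 8 from the
  average over \<open>t\<close>.\<close>

lemma sum_abs_progression_cov_le:
  fixes x y :: real and q D :: nat
  assumes q: "q > 0" and y: "y \<ge> 1" and xy: "x = real q * y\<^sup>2"
  defines "S \<equiv> {d. d \<in> {1..D} \<and> coprime d q}"
    and "M \<equiv> \<lambda>d. nat \<lfloor>x / (real d)\<^sup>2\<rfloor>"
  shows "(\<Sum>a\<in>S. \<Sum>b\<in>S. \<bar>progression_cov q (a\<^sup>2) (M a) (b\<^sup>2) (M b)\<bar>)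
     \<le> real q * (16 * real (card {d. d dvd q}) * (harm q)\<^sup>2 * (y + 2 * (real D)\<^sup>2 / real q) + y * (harm D) ^ 3)"
proof -
  define G where "G = nat \<lfloor>y\<rfloor>"
  define Kp where "Kp = (\<lambda>a b. \<Sum>h\<in>{1..<q}. recip_sym q (h * a\<^sup>2 mod q) * recip_sym q (h * b\<^sup>2 mod q))"
  define Z where "Z = {(a, b). a \<in> {1..D} \<and> b \<in> {1..D} \<and> coprime a q \<and> coprime b q \<and> gcd a b \<le> G}"
  define \<tau> where "\<tau> = real (card {d. d dvd q})"
  have finS: "finite S" unfolding S_def by auto
  have "Z \<subseteq> {1..D} \<times> {1..D}" unfolding Z_def by auto
  hence finZ: "finite Z" by (rule finite_subset) auto
  have x0: "x > 0" using q y xy by simp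
  have pointwise: "\<bar>progression_cov q (a\<^sup>2) (M a) (b\<^sup>2) (M b)\<bar>
      \<le> (if (a, b) \<in> Z then real q * Kp a b else 0) + real q * y * (real (gcd a b) / (real a * real b))"
    if ab: "a \<in> S" "b \<in> S" for a b
  proof -
    have ab0: "a > 0" "b > 0" "coprime (a\<^sup>2) q" "coprime (b\<^sup>2) q" using ab unfolding S_def by auto
    show ?thesis
    proof (cases "gcd a b \<le> G")
      case True
      hence "(a, b) \<in> Z" using ab unfolding S_def Z_def by auto
      moreover have "\<bar>progression_cov q (a\<^sup>2) (M a) (b\<^sup>2) (M b)\<bar> \<le> real q * Kp a b"
        unfolding Kp_def by (rule progression_cov_fourier[OF q ab0(3,4)])
      moreover have "0 \<le> real q * y * (real (gcd a b) / (real a * real b))" using y by simp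
      ultimately show ?thesis by simp
    next
      case False
      \<comment> \<open>Both \<open>a\<close> and \<open>b\<close> are at least their gcd, hence at
        least \<open>y\<close>; then \<open>x / a\<^sup>2 \<le> q\<close>, likewise for
        \<open>b\<close>, and the counts are short enough for the trivial bound.\<close>
      hence gy: "real (gcd a b) \<ge> y" unfolding G_def by linarith
      have "real (gcd a b) \<le> real a" "real (gcd a b) \<le> real b"
        using ab0 by (auto intro!: of_nat_mono dvd_imp_le)
      hence ya: "real a \<ge> y" "real b \<ge> y" using gy by auto
      have M_le: "real (M d) \<le> x / (real d)\<^sup>2" for d unfolding M_def using x0 by simp
      have Mq: "M d \<le> q" if "real d \<ge> y" for d
      proof -
        have "y\<^sup>2 \<le> (real d)\<^sup>2" using that y by (intro power_mono) auto
        hence "x \<le> real q * (real d)\<^sup>2" unfolding xy by (intro mult_left_mono) auto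
        moreover have "(real d)\<^sup>2 > 0" using that y by simp
        ultimately have "x / (real d)\<^sup>2 \<le> real q" by (simp add: divide_le_eq)
        hence "real (M d) \<le> real q" using M_le[of d] by linarith
        thus ?thesis by simp
      qed
      have "\<bar>progression_cov q (a\<^sup>2) (M a) (b\<^sup>2) (M b)\<bar> \<le> real (min (M a) (M b))"
        using ab0 ya by (intro progression_cov_trivial q Mq) auto
      also have "\<dots> \<le> x / (real a * real b)"
      proof (cases "a \<le> b")
        case True
        have "real (min (M a) (M b)) \<le> x / (real b)\<^sup>2" using M_le[of b] by (simp add: min_le_iff_disj)
        also have "\<dots> \<le> x / (real a * real b)"
          using True x0 ab0 by (intro divide_left_mono) (auto simp: power2_eq_square)
        finally show ?thesis .
      next
        case False
        have "real (min (M a) (M b)) \<le> x / (real a)\<^sup>2" using M_le[of a] by (simp add: min_le_iff_disj)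
        also have "\<dots> \<le> x / (real a * real b)"
          using False x0 ab0 by (intro divide_left_mono) (auto simp: power2_eq_square)
        finally show ?thesis .
      qed
      \<comment> \<open>One factor \<open>y\<close> of \<open>x = q * y\<^sup>2\<close> is traded
        for the gcd, which is at least as large; the sum of \<open>gcd a b / (a * b)\<close> is only
        a power of a logarithm.\<close>
      also have "\<dots> = real q * y * (y / (real a * real b))" by (simp add: xy power2_eq_square)
      also have "\<dots> \<le> real q * y * (real (gcd a b) / (real a * real b))"
        using gy y by (intro mult_left_mono divide_right_mono) auto
      moreover have "0 \<le> (if (a, b) \<in> Z then real q * Kp a b else 0)"
        unfolding Kp_def by (auto intro!: mult_nonneg_nonneg sum_nonneg recip_sym_nonneg)
      ultimately show ?thesis by linarith
    qed
  qed
  have "(\<Sum>a\<in>S. \<Sum>b\<in>S. \<bar>progression_cov q (a\<^sup>2) (M a) (b\<^sup>2) (M b)\<bar>)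
     \<le> (\<Sum>a\<in>S. \<Sum>b\<in>S. (if (a, b) \<in> Z then real q * Kp a b else 0) + real q * y * (real (gcd a b) / (real a * real b)))"
    by (intro sum_mono pointwise)
  also have "\<dots> = (\<Sum>a\<in>S. \<Sum>b\<in>S. if (a, b) \<in> Z then real q * Kp a b else 0)
       + real q * y * (\<Sum>a\<in>S. \<Sum>b\<in>S. real (gcd a b) / (real a * real b))"
    by (simp only: sum.distrib sum_distrib_left)
  also have "(\<Sum>a\<in>S. \<Sum>b\<in>S. if (a, b) \<in> Z then real q * Kp a b else 0) = real q * (\<Sum>(a, b)\<in>Z. Kp a b)"
  proof -
    have "(\<Sum>a\<in>S. \<Sum>b\<in>S. if (a, b) \<in> Z then real q * Kp a b else 0)
       = (\<Sum>z\<in>S \<times> S. if z \<in> Z then real q * Kp (fst z) (snd z) else 0)"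
      by (simp add: sum.cartesian_product case_prod_beta)
    also have "\<dots> = (\<Sum>z\<in>Z. real q * Kp (fst z) (snd z))"
      by (rule sum.mono_neutral_cong_right) (use finS in \<open>auto simp: Z_def S_def\<close>)
    finally show ?thesis by (simp add: sum_distrib_left case_prod_beta)
  qed
  also have "(\<Sum>(a, b)\<in>Z. Kp a b) \<le> (2 * (y + 2 * (real D)\<^sup>2 / real q)) * (8 * \<tau> * (harm q)\<^sup>2)"
    unfolding Kp_def \<tau>_def
  proof (rule sum_recip_sym_pairs_le[OF q finZ])
    fix t
    have "{(a, b). (a, b) \<in> Z \<and> [a = t * b] (mod q)}
        = {(a, b). (a \<in> {1..D} \<and> b \<in> {1..D} \<and> coprime a q \<and> coprime b q \<and> gcd a b \<le> G) \<and> [a = t * b] (mod q)}"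
      unfolding Z_def by auto
    hence "real (card {(a, b). (a, b) \<in> Z \<and> [a = t * b] (mod q)}) \<le> 2 * (real G + 2 * (real D)\<^sup>2 / real q)"
      using card_pairs_gcd_le_cong[OF q, of D G t] by simp
    moreover have "real G \<le> y" using y unfolding G_def by linarith
    hence "2 * (real G + 2 * (real D)\<^sup>2 / real q) \<le> 2 * (y + 2 * (real D)\<^sup>2 / real q)" by simp
    ultimately show "real (card {(a, b). (a, b) \<in> Z \<and> [a = t * b] (mod q)}) \<le> 2 * (y + 2 * (real D)\<^sup>2 / real q)"
      by (rule order_trans)
  qed (auto simp: Z_def)
  also have "(\<Sum>a\<in>S. \<Sum>b\<in>S. real (gcd a b) / (real a * real b)) \<le> (harm D) ^ 3"
  proof -
    have "(\<Sum>a\<in>S. \<Sum>b\<in>S. real (gcd a b) / (real a * real b)) \<le> (\<Sum>a\<in>{1..D}. \<Sum>b\<in>S. real (gcd a b) / (real a * real b))"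
      by (rule sum_mono2) (auto simp: S_def intro!: sum_nonneg)
    also have "\<dots> \<le> (\<Sum>a\<in>{1..D}. \<Sum>b\<in>{1..D}. real (gcd a b) / (real a * real b))"
      by (intro sum_mono sum_mono2) (auto simp: S_def)
    also have "\<dots> \<le> (harm D) ^ 3" by (rule sum_gcd_div_le)
    finally show ?thesis .
  qed
  finally have "(\<Sum>a\<in>S. \<Sum>b\<in>S. \<bar>progression_cov q (a\<^sup>2) (M a) (b\<^sup>2) (M b)\<bar>)
     \<le> real q * ((2 * (y + 2 * (real D)\<^sup>2 / real q)) * (8 * \<tau> * (harm q)\<^sup>2)) + real q * y * (harm D) ^ 3"
    using y by (simp add: mult_left_mono)
  thus ?thesis unfolding \<tau>_def by (simp add: algebra_simps)
qed

section \<open>Decomposition of the error and the exceptional set\<close>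

text \<open>A square divisor of an integer coprime to \<open>q\<close> is coprime to
  \<open>q\<close>, so only such \<open>d\<close> survive. Any \<open>N \<ge> x\<close> may serve as
  the upper limit, because the counts are empty once \<open>d\<^sup>2 > x\<close>.\<close>

lemma sqfree_sum_eq_sum_moebius:
  fixes x :: real and q a N :: nat
  assumes q: "q > 0" and a: "coprime a q" and x: "x \<ge> 0" and N: "x \<le> real N"
  shows "sqfree_sum x q a = (\<Sum>d | d \<in> {1..N} \<and> coprime d q.
           real_of_int (moebius_mu d) * real (progression_count q (d\<^sup>2) (nat \<lfloor>x / (real d)\<^sup>2\<rfloor>) a))"
proof -
  define X where "X = {n. 1 \<le> n \<and> real n \<le> x \<and> [n = a] (mod q)}"
  have XN: "n \<le> N" if "n \<in> X" for n using that N unfolding X_def by simp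
  have "X \<subseteq> {..N}" using XN by auto
  hence finX: "finite X" by (rule finite_subset) auto
  have "sqfree_sum x q a = (\<Sum>n\<in>X. real_of_int \<bar>moebius_mu n\<bar>)" unfolding sqfree_sum_def X_def ..
  also have "\<dots> = (\<Sum>n\<in>X. \<Sum>d\<in>{1..N}. if d\<^sup>2 dvd n then real_of_int (moebius_mu d) else 0)"
  proof (rule sum.cong[OF refl])
    fix n assume n: "n \<in> X"
    hence n0: "n > 0" unfolding X_def by simp
    have "d \<in> {1..N}" if d: "d\<^sup>2 dvd n" for d
    proof -
      have "d \<noteq> 0" using d n0 by (intro notI) simp
      moreover have "d \<le> d\<^sup>2" by (simp add: power2_eq_square)
      moreover have "d\<^sup>2 \<le> n" using d n0 by (rule dvd_imp_le)
      ultimately show ?thesis using XN[OF n] by simp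
    qed
    hence "{d. d\<^sup>2 dvd n} = {d\<in>{1..N}. d\<^sup>2 dvd n}" by auto
    hence "real_of_int \<bar>moebius_mu n\<bar> = (\<Sum>d\<in>{d\<in>{1..N}. d\<^sup>2 dvd n}. real_of_int (moebius_mu d))"
      using abs_moebius_mu_eq_sum[OF n0] by simp
    also have "\<dots> = (\<Sum>d\<in>{1..N}. if d\<^sup>2 dvd n then real_of_int (moebius_mu d) else 0)"
      by (rule sum.inter_filter) simp
    finally show "real_of_int \<bar>moebius_mu n\<bar> = \<dots>" .
  qed
  also have "\<dots> = (\<Sum>d\<in>{1..N}. \<Sum>n\<in>X. if d\<^sup>2 dvd n then real_of_int (moebius_mu d) else 0)"
    by (rule sum.swap)
  also have "\<dots> = (\<Sum>d\<in>{1..N}. real_of_int (moebius_mu d) * real (card {n\<in>X. d\<^sup>2 dvd n}))"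
    using finX by (intro sum.cong refl) (simp flip: sum.inter_filter)
  also have "\<dots> = (\<Sum>d | d \<in> {1..N} \<and> coprime d q. real_of_int (moebius_mu d) * real (card {n\<in>X. d\<^sup>2 dvd n}))"
  proof (rule sum.mono_neutral_right)
    show "\<forall>d\<in>{1..N} - {d. d \<in> {1..N} \<and> coprime d q}. real_of_int (moebius_mu d) * real (card {n\<in>X. d\<^sup>2 dvd n}) = 0"
    proof
      fix d assume d: "d \<in> {1..N} - {d. d \<in> {1..N} \<and> coprime d q}"
      have "\<not> d\<^sup>2 dvd n" if n: "n \<in> X" for n
      proof
        assume dn: "d\<^sup>2 dvd n"
        have "[a = n] (mod q)" using n unfolding X_def by (simp add: cong_sym_eq)
        hence "coprime n q" using a by (rule cong_imp_coprime)
        hence "coprime (d\<^sup>2) q" using dn by (rule coprime_divisors[OF _ dvd_refl, rotated])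
        thus False using d by auto
      qed
      hence none: "{n\<in>X. d\<^sup>2 dvd n} = {}" by blast
      show "real_of_int (moebius_mu d) * real (card {n\<in>X. d\<^sup>2 dvd n}) = 0" unfolding none by simp
    qed
  qed auto
  also have "\<dots> = (\<Sum>d | d \<in> {1..N} \<and> coprime d q.
           real_of_int (moebius_mu d) * real (progression_count q (d\<^sup>2) (nat \<lfloor>x / (real d)\<^sup>2\<rfloor>) a))"
  proof (rule sum.cong[OF refl])
    fix d assume "d \<in> {d. d \<in> {1..N} \<and> coprime d q}"
    hence d0: "d > 0" by auto
    have le_iff: "m \<le> nat \<lfloor>x / (real d)\<^sup>2\<rfloor> \<longleftrightarrow> real (d\<^sup>2 * m) \<le> x" for m
    proof -
      have "m \<le> nat \<lfloor>x / (real d)\<^sup>2\<rfloor> \<longleftrightarrow> real m \<le> x / (real d)\<^sup>2"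
        using x by (simp add: le_nat_iff le_floor_iff)
      thus ?thesis using d0 by (simp add: pos_le_divide_eq mult.commute)
    qed
    have "{n\<in>X. d\<^sup>2 dvd n} = (\<lambda>m. d\<^sup>2 * m) ` {m \<in> {1..nat \<lfloor>x / (real d)\<^sup>2\<rfloor>}. [d\<^sup>2 * m = a] (mod q)}"
    proof (intro equalityI subsetI)
      fix n assume n: "n \<in> {n\<in>X. d\<^sup>2 dvd n}"
      then obtain m where nm: "n = d\<^sup>2 * m" by (auto elim: dvdE)
      hence m: "n = d\<^sup>2 * m" "1 \<le> d\<^sup>2 * m" "real (d\<^sup>2 * m) \<le> x" "[d\<^sup>2 * m = a] (mod q)"
        using n unfolding X_def nm by simp_all
      have "m \<noteq> 0" using m(2) by (intro notI) simp
      thus "n \<in> (\<lambda>m. d\<^sup>2 * m) ` {m \<in> {1..nat \<lfloor>x / (real d)\<^sup>2\<rfloor>}. [d\<^sup>2 * m = a] (mod q)}"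
        using m le_iff[of m] by auto
    next
      fix n assume "n \<in> (\<lambda>m. d\<^sup>2 * m) ` {m \<in> {1..nat \<lfloor>x / (real d)\<^sup>2\<rfloor>}. [d\<^sup>2 * m = a] (mod q)}"
      then obtain m where m: "n = d\<^sup>2 * m" "1 \<le> m" "m \<le> nat \<lfloor>x / (real d)\<^sup>2\<rfloor>" "[d\<^sup>2 * m = a] (mod q)" by auto
      have "1 \<le> d\<^sup>2 * m" using d0 m(2) by (simp add: Suc_le_eq)
      thus "n \<in> {n\<in>X. d\<^sup>2 dvd n}" unfolding X_def using m le_iff[of m] by auto
    qed
    hence "card {n\<in>X. d\<^sup>2 dvd n} = progression_count q (d\<^sup>2) (nat \<lfloor>x / (real d)\<^sup>2\<rfloor>) a"
      unfolding progression_count_def using d0 by (simp add: card_image inj_on_def)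
    thus "real_of_int (moebius_mu d) * real (card {n\<in>X. d\<^sup>2 dvd n})
       = real_of_int (moebius_mu d) * real (progression_count q (d\<^sup>2) (nat \<lfloor>x / (real d)\<^sup>2\<rfloor>) a)" by simp
  qed
  finally show ?thesis .
qed

text \<open>The error splits into a centred part, a part independent of the residue and a tail. The
  second is at most \<open>T / 2\<close> by \<open>main\<close>, so an error above \<open>T\<close>
  forces one of the others to reach \<open>T / 4\<close>; Chebyshev's and Markov's inequalities then
  give \<open>16 / T\<^sup>2\<close> and \<open>4 / T\<close>.\<close>

lemma card_sqfree_error_gt_le:
  fixes x y T :: real and q D :: nat
  assumes q: "q > 0" and y: "y \<ge> 1" and xy: "x = real q * y\<^sup>2" and D: "D \<ge> 1" and T: "T > 0"
    and main: "real D / real q + x / (real q * real D) \<le> T / 2"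
  shows "real (card {a \<in> totatives q. \<bar>sqfree_error x q a\<bar> > T})
     \<le> 16 / T\<^sup>2 * (real q * (16 * real (card {d. d dvd q}) * (harm q)\<^sup>2 * (y + 2 * (real D)\<^sup>2 / real q) + y * (harm D) ^ 3))
       + 4 / T * (x / real D)"
proof -
  have x0: "x > 0" using q y xy by simp
  \<comment> \<open>The maximum lets the range of \<open>d\<close> contain \<open>{1..D}\<close>
    even if \<open>D\<close> exceeds \<open>x\<close>.\<close>
  define N where "N = max D (nat \<lceil>x\<rceil>)"
  have N: "x \<le> real N" "D \<le> N" unfolding N_def by linarith+
  define S where "S = {d. d \<in> {1..D} \<and> coprime d q}"
  define R where "R = {d. d \<in> {1..N} \<and> coprime d q} - S"
  define M where "M = (\<lambda>d::nat. nat \<lfloor>x / (real d)\<^sup>2\<rfloor>)"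
  define c where "c = (\<lambda>d a. real (progression_count q (d\<^sup>2) (M d) a))"
  define \<mu> where "\<mu> = (\<lambda>d. real_of_int (moebius_mu d))"
  \<comment> \<open>\<open>A\<close> is the centred part, \<open>B\<close> the mean of the kept part
    minus the expected main term, and \<open>C\<close> the tail with its signs dropped.\<close>
  define A where "A = (\<lambda>a. \<Sum>d\<in>S. \<mu> d * (c d a - real (M d) / real q))"
  define B where "B = (\<Sum>d\<in>S. \<mu> d * (real (M d) / real q)) - sqfree_const q * (x / real q)"
  define C where "C = (\<lambda>a. \<Sum>d\<in>R. c d a)"
  have fin: "finite S" "finite R" unfolding S_def R_def by auto
  have mu1: "\<bar>\<mu> d\<bar> \<le> 1" for d unfolding \<mu>_def by (rule abs_moebius_mu_le)
  have c0: "c d a \<ge> 0" for d a by (simp add: c_def)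
  have M_le: "real (M d) \<le> x / (real d)\<^sup>2" for d unfolding M_def using x0 by simp

  have error_le: "\<bar>sqfree_error x q a\<bar> \<le> \<bar>A a\<bar> + \<bar>B\<bar> + C a" if a: "a \<in> totatives q" for a
  proof -
    have "coprime a q" using a by (simp add: totatives_def)
    hence "sqfree_sum x q a = (\<Sum>d | d \<in> {1..N} \<and> coprime d q. \<mu> d * c d a)"
      unfolding \<mu>_def c_def M_def using q x0 N by (intro sqfree_sum_eq_sum_moebius) auto
    also have "{d. d \<in> {1..N} \<and> coprime d q} = S \<union> R"
      unfolding R_def using N(2) by (auto simp: S_def)
    also have "(\<Sum>d\<in>S \<union> R. \<mu> d * c d a) = (\<Sum>d\<in>S. \<mu> d * c d a) + (\<Sum>d\<in>R. \<mu> d * c d a)"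
      using fin by (intro sum.union_disjoint) (auto simp: R_def)
    also have "(\<Sum>d\<in>S. \<mu> d * c d a) = A a + (\<Sum>d\<in>S. \<mu> d * (real (M d) / real q))"
      unfolding A_def by (simp add: right_diff_distrib sum_subtractf)
    finally have "sqfree_error x q a = A a + B + (\<Sum>d\<in>R. \<mu> d * c d a)"
      unfolding sqfree_error_def B_def by simp
    moreover have "\<bar>\<Sum>d\<in>R. \<mu> d * c d a\<bar> \<le> (\<Sum>d\<in>R. \<bar>\<mu> d * c d a\<bar>)" by (rule sum_abs)
    moreover have "(\<Sum>d\<in>R. \<bar>\<mu> d * c d a\<bar>) \<le> C a"
      unfolding C_def using mult_right_mono[OF mu1 c0] c0 by (intro sum_mono) (simp add: abs_mult)
    ultimately show ?thesis by linarith
  qed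

  have B_le: "\<bar>B\<bar> \<le> T / 2"
  proof -
    \<comment> \<open>\<open>B1\<close> collects the rounding in \<open>M d\<close>, at most
      \<open>1 / q\<close> for each \<open>d\<close>; \<open>B2\<close> is the truncation of the
      Euler product.\<close>
    define B1 where "B1 = (\<Sum>d\<in>S. \<mu> d * ((real (M d) - x / (real d)\<^sup>2) / real q))"
    define B2 where "B2 = x / real q * ((\<Sum>d\<in>S. \<mu> d / (real d)\<^sup>2) - sqfree_const q)"
    have "B = B1 + B2"
      unfolding B_def B1_def B2_def by (simp add: right_diff_distrib diff_divide_distrib sum_subtractf sum_distrib_left algebra_simps)
    moreover have "\<bar>B1\<bar> \<le> real D / real q"
    proof -
      have "\<bar>B1\<bar>
             \<le> (\<Sum>d\<in>S. \<bar>\<mu> d * ((real (M d) - x / (real d)\<^sup>2) / real q)\<bar>)" unfolding B1_def by (rule sum_abs)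
      also have "\<dots> \<le> (\<Sum>d\<in>S. 1 * (1 / real q))"
      proof (rule sum_mono)
        fix d
        have "x / (real d)\<^sup>2 \<ge> 0" using x0 by simp
        hence "\<bar>real (M d) - x / (real d)\<^sup>2\<bar> \<le> 1" unfolding M_def by linarith
        hence "\<bar>(real (M d) - x / (real d)\<^sup>2) / real q\<bar> \<le> 1 / real q"
          by (simp add: divide_right_mono)
        thus "\<bar>\<mu> d * ((real (M d) - x / (real d)\<^sup>2) / real q)\<bar> \<le> 1 * (1 / real q)"
          unfolding abs_mult by (intro mult_mono mu1) auto
      qed
      also have "\<dots> = real (card S) / real q" by simp
      also have "\<dots> \<le> real D / real q"
      proof -
        have "card S \<le> card {1..D}" by (intro card_mono) (auto simp: S_def)
        thus ?thesis by (simp add: divide_right_mono)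
      qed
      finally show ?thesis .
    qed
    moreover have "\<bar>B2\<bar> \<le> x / (real q * real D)"
    proof -
      have "\<bar>(\<Sum>d\<in>S. \<mu> d / (real d)\<^sup>2) - sqfree_const q\<bar> \<le> 1 / real D"
        unfolding S_def \<mu>_def by (rule sqfree_const_partial_sum[OF D q])
      hence "x / real q * \<bar>(\<Sum>d\<in>S. \<mu> d / (real d)\<^sup>2) - sqfree_const q\<bar> \<le> x / real q * (1 / real D)"
        using x0 by (intro mult_left_mono) auto
      thus ?thesis using x0 by (simp add: B2_def abs_mult)
    qed
    ultimately show ?thesis using main by linarith
  qed

  have A_le: "(\<Sum>a\<in>{1..q}. (A a)\<^sup>2)
     \<le> real q * (16 * real (card {d. d dvd q}) * (harm q)\<^sup>2 * (y + 2 * (real D)\<^sup>2 / real q) + y * (harm D) ^ 3)"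
  proof -
    define f where "f = (\<lambda>d a. c d a - real (M d) / real q)"
    have "(\<Sum>a\<in>{1..q}. (A a)\<^sup>2) = (\<Sum>a\<in>{1..q}. \<Sum>d\<in>S. \<Sum>e\<in>S. \<mu> d * f d a * (\<mu> e * f e a))"
      unfolding A_def f_def by (simp only: power2_eq_square sum_product)
    also have "\<dots> = (\<Sum>d\<in>S. \<Sum>a\<in>{1..q}. \<Sum>e\<in>S. \<mu> d * f d a * (\<mu> e * f e a))" by (rule sum.swap)
    also have "\<dots> = (\<Sum>d\<in>S. \<Sum>e\<in>S. \<Sum>a\<in>{1..q}. \<mu> d * f d a * (\<mu> e * f e a))"
      by (intro sum.cong refl sum.swap)
    also have "\<dots> = (\<Sum>d\<in>S. \<Sum>e\<in>S. \<mu> d * \<mu> e * progression_cov q (d\<^sup>2) (M d) (e\<^sup>2) (M e))"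
      unfolding progression_cov_def sum_distrib_left f_def c_def by (intro sum.cong refl) (simp only: mult_ac)
    also have "\<dots> \<le> (\<Sum>d\<in>S. \<Sum>e\<in>S. \<bar>progression_cov q (d\<^sup>2) (M d) (e\<^sup>2) (M e)\<bar>)"
    proof (intro sum_mono)
      fix d e
      have "\<bar>\<mu> d\<bar> * \<bar>\<mu> e\<bar> \<le> 1 * 1" by (intro mult_mono mu1) auto
      hence "\<bar>\<mu> d * \<mu> e\<bar> * \<bar>progression_cov q (d\<^sup>2) (M d) (e\<^sup>2) (M e)\<bar> \<le> 1 * \<bar>progression_cov q (d\<^sup>2) (M d) (e\<^sup>2) (M e)\<bar>"
        by (intro mult_right_mono) (auto simp: abs_mult)
      thus "\<mu> d * \<mu> e * progression_cov q (d\<^sup>2) (M d) (e\<^sup>2) (M e) \<le> \<bar>progression_cov q (d\<^sup>2) (M d) (e\<^sup>2) (M e)\<bar>"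
        by (simp add: abs_mult[symmetric])
    qed
    also have "\<dots> \<le> real q * (16 * real (card {d. d dvd q}) * (harm q)\<^sup>2 * (y + 2 * (real D)\<^sup>2 / real q) + y * (harm D) ^ 3)"
      unfolding S_def M_def by (rule sum_abs_progression_cov_le[OF q y xy])
    finally show ?thesis .
  qed

  have C_le: "(\<Sum>a\<in>{1..q}. C a) \<le> x / real D"
  proof -
    have "(\<Sum>a\<in>{1..q}. C a) = (\<Sum>d\<in>R. \<Sum>a\<in>{1..q}. c d a)" unfolding C_def by (rule sum.swap)
    also have "\<dots> = (\<Sum>d\<in>R. real (M d))" unfolding c_def by (simp only: sum_progression_count[OF q])
    also have "\<dots> \<le> (\<Sum>d\<in>R. x * (1 / (real d)\<^sup>2))" using M_le by (intro sum_mono) simp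
    also have "\<dots> = x * (\<Sum>d\<in>R. 1 / (real d)\<^sup>2)" by (simp add: sum_distrib_left)
    also have "\<dots> \<le> x * (1 / real D)"
      using x0 D fin by (intro mult_left_mono sum_inverse_squares_le) (auto simp: R_def S_def)
    finally show ?thesis by simp
  qed

  define Bad where "Bad = {a \<in> totatives q. \<bar>sqfree_error x q a\<bar> > T}"
  have Bad_sub: "Bad \<subseteq> {1..q}" unfolding Bad_def totatives_def by auto
  have C0: "C a \<ge> 0" for a unfolding C_def by (intro sum_nonneg c0)
  have "real (card Bad) = (\<Sum>a\<in>Bad. 1)" by simp
  also have "\<dots> \<le> (\<Sum>a\<in>Bad. 16 / T\<^sup>2 * (A a)\<^sup>2 + 4 / T * C a)"
  proof (rule sum_mono)
    fix a assume a: "a \<in> Bad"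
    hence "T < \<bar>A a\<bar> + \<bar>B\<bar> + C a" using error_le[of a] unfolding Bad_def by auto
    hence "T / 4 \<le> \<bar>A a\<bar> \<or> T / 4 \<le> C a" using B_le by linarith
    thus "1 \<le> 16 / T\<^sup>2 * (A a)\<^sup>2 + 4 / T * C a"
    proof
      assume "T / 4 \<le> \<bar>A a\<bar>"
      hence "(T / 4)\<^sup>2 \<le> \<bar>A a\<bar>\<^sup>2" using T by (intro power_mono) auto
      hence "1 \<le> 16 / T\<^sup>2 * (A a)\<^sup>2" using T by (simp add: power_divide field_simps)
      moreover have "0 \<le> 4 / T * C a" using C0 T by simp
      ultimately show ?thesis by linarith
    next
      assume "T / 4 \<le> C a"
      hence "1 \<le> 4 / T * C a" using T by (simp add: field_simps)
      moreover have "0 \<le> 16 / T\<^sup>2 * (A a)\<^sup>2" by simp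
      ultimately show ?thesis by linarith
    qed
  qed
  also have "\<dots> \<le> (\<Sum>a\<in>{1..q}. 16 / T\<^sup>2 * (A a)\<^sup>2 + 4 / T * C a)"
    using Bad_sub C0 T by (intro sum_mono2) auto
  also have "\<dots> = 16 / T\<^sup>2 * (\<Sum>a\<in>{1..q}. (A a)\<^sup>2) + 4 / T * (\<Sum>a\<in>{1..q}. C a)"
    by (simp only: sum.distrib sum_distrib_left)
  also have "\<dots> \<le> 16 / T\<^sup>2 * (real q * (16 * real (card {d. d dvd q}) * (harm q)\<^sup>2 * (y + 2 * (real D)\<^sup>2 / real q) + y * (harm D) ^ 3))
       + 4 / T * (x / real D)"
    using A_le C_le T by (intro add_mono mult_left_mono) auto
  finally show ?thesis unfolding Bad_def .
qed

section \<open>Choice of parameters and conclusion\<close>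

lemma powr_square: "((x::real) powr a)\<^sup>2 = x powr (2 * a)"
proof -
  have "2 * a = a + a" by simp
  thus ?thesis by (simp only: powr_add power2_eq_square)
qed

theorem corollary2:
  fixes \<epsilon> :: real
  assumes "\<epsilon> > 0"
  shows "\<exists>C>0. \<forall>(x::real) (q::nat). x \<ge> 1 \<and> q \<ge> 1 \<and> x powr (1/2) \<le> real q \<and> real q \<le> x \<longrightarrow>
           \<bar>1 / real (totient q) *
             real (card {a \<in> totatives q. \<bar>sqfree_error x q a\<bar> > (x / real q) powr (1/4) * x powr \<epsilon>})\<bar>
           \<le> C * x powr (-\<epsilon>)"
proof -
  \<comment> \<open>These values give \<open>3 * \<delta> + 2 * \<eta> - 2 * \<epsilon> = -
    \<epsilon> - \<delta>\<close> and
    \<open>- \<eta> - \<epsilon> \<le> - \<epsilon> - \<delta>\<close>. So both terms of the count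
    have \<open>x powr (- \<delta>)\<close> to spare, which absorbs the divisor bound on
    \<open>q / totient q\<close>.\<close>
  define \<eta> where "\<eta> = \<epsilon> / 4"
  define \<delta> where "\<delta> = \<epsilon> / 8"
  \<comment> \<open>\<open>D\<close> is bounded by \<open>x powr (1 + \<eta>)\<close>, so with this
    exponent \<open>harm D\<close> still costs only \<open>x powr \<delta>\<close>.\<close>
  define \<delta>' where "\<delta>' = \<delta> / (1 + \<eta>)"
  have pos: "\<eta> > 0" "\<delta> > 0" "\<delta>' > 0" using assms by (auto simp: \<eta>_def \<delta>_def \<delta>'_def add_pos_pos)
  obtain C1 where C1: "C1 > 0" "\<And>n. n > 0 \<Longrightarrow> real (divisor_prod n) \<le> C1 * real n powr \<delta>"
    using divisor_prod_le_powr[OF pos(2)] by blast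
  define C2 where "C2 = 1 + 1 / \<delta>"
  define C3 where "C3 = 1 + 1 / \<delta>'"
  have C23: "C2 > 0" "C3 > 0" using pos by (auto simp: C2_def C3_def add_pos_pos)
  define K where "K = 16 * (48 * C1 * C2\<^sup>2 + C3 ^ 3) + 8"
  have K0: "K > 0" using C1 C23 unfolding K_def by (intro add_nonneg_pos mult_nonneg_nonneg) auto
  define C where "C = 36 + C1 * K"
  have C0: "C > 0" using C1 K0 by (simp add: C_def add_pos_pos)
  show ?thesis
  proof (intro exI[of _ C] conjI C0 allI impI)
    fix x :: real and q :: nat
    assume H: "x \<ge> 1 \<and> q \<ge> 1 \<and> x powr (1/2) \<le> real q \<and> real q \<le> x"
    hence x: "x \<ge> 1" and q: "q > 0" and qx: "x powr (1/2) \<le> real q" "real q \<le> x" by auto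
    define T where "T = (x / real q) powr (1/4) * x powr \<epsilon>"
    define Bad where "Bad = {a \<in> totatives q. \<bar>sqfree_error x q a\<bar> > T}"
    have tot0: "real (totient q) > 0" using q by simp
    have "real (card Bad) / real (totient q) \<le> C * x powr (-\<epsilon>)"
    \<comment> \<open>In the first case the proportion is at most 1, and
      \<open>36 = 6\<^sup>2\<close> makes up for \<open>x powr (- \<epsilon>)\<close>. In the
      second, the factor 6 brings \<open>3 * (y powr (1/2) * x powr \<eta>)\<close>, which bounds
      the residue-independent part, below \<open>T / 2\<close>.\<close>
    proof (cases "x powr (\<epsilon> - \<eta>) < 6")
      case True
      have "card Bad \<le> card (totatives q)" unfolding Bad_def by (intro card_mono) auto
      hence "real (card Bad) / real (totient q) \<le> 1" using tot0 by (simp add: totient_def)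
      also have "1 \<le> 36 * x powr (-\<epsilon>)"
      proof -
        have "x powr \<epsilon> \<le> x powr ((\<epsilon> - \<eta>) * 2)"
          using x assms by (intro powr_mono) (auto simp: \<eta>_def)
        also have "\<dots> = (x powr (\<epsilon> - \<eta>))\<^sup>2" by (simp add: power2_eq_square algebra_simps flip: powr_add)
        also have "\<dots> \<le> 6\<^sup>2" using True by (intro power_mono) auto
        finally show ?thesis using x by (simp add: powr_minus field_simps)
      qed
      also have "\<dots> \<le> C * x powr (-\<epsilon>)" using C1 K0 by (intro mult_right_mono) (auto simp: C_def)
      finally show ?thesis .
    next
      case False
      hence large: "6 \<le> x powr (\<epsilon> - \<eta>)" by simp
      define y where "y = (x / real q) powr (1/2)"
      have y1: "y \<ge> 1" using qx q unfolding y_def by (intro ge_one_powr_ge_zero) auto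
      have y2: "y\<^sup>2 = x / real q" using x q by (simp add: y_def powr_powr flip: powr_realpow)
      have xy: "x = real q * y\<^sup>2" using q by (simp add: y2)
      have yh: "y powr (1/2) = (x / real q) powr (1/4)" by (simp add: y_def powr_powr)
      have Tdef: "T = y powr (1/2) * x powr \<epsilon>" by (simp add: T_def yh)
      have T0: "T > 0" using y1 x by (simp add: Tdef)
      have y_sq_le: "y\<^sup>2 \<le> real q"
      proof -
        have "x = x powr (1/2) * x powr (1/2)" using x by (simp flip: powr_add)
        also have "\<dots> \<le> real q * real q" using qx by (intro mult_mono) auto
        finally show ?thesis unfolding y2 using q by (simp add: divide_le_eq)
      qed
      have y_le_q: "y \<le> real q" using y_sq_le y1 self_le_power[of y 2] by simp
      define w where "w = y powr (3/2) * x powr \<eta>"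
      have w1: "w \<ge> 1" unfolding w_def
        using mult_mono[of 1 "y powr (3/2)" 1 "x powr \<eta>"] y1 x pos by (simp add: ge_one_powr_ge_zero)
      define D where "D = nat \<lfloor>w\<rfloor>"
      have "D \<ge> 1" using w1 unfolding D_def by linarith
      moreover have "real D \<le> w" "w - 1 < real D" using w1 unfolding D_def by linarith+
      \<comment> \<open>Rounding costs at most a factor 2, since
        \<open>w < D + 1 \<le> 2 * D\<close>.\<close>
      ultimately have D: "D \<ge> 1" "real D \<le> w" "w / 2 \<le> real D" by linarith+
      have w_sq: "w\<^sup>2 = y\<^sup>2 * y * x powr (2 * \<eta>)"
      proof -
        have "w\<^sup>2 = (y powr (3/2))\<^sup>2 * (x powr \<eta>)\<^sup>2" by (simp add: w_def power_mult_distrib)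
        also have "(y powr (3/2))\<^sup>2 = y ^ 3" using y1 by (simp add: power2_eq_square flip: powr_add)
        also have "(x powr \<eta>)\<^sup>2 = x powr (2 * \<eta>)" by (rule powr_square)
        finally show ?thesis by (simp add: power3_eq_cube power2_eq_square)
      qed
      have yw: "y powr (3/2) = y powr (1/2) * y" using y1 powr_add[of y "1/2" 1] by simp
      have xD: "x / real D \<le> 2 * real q * y powr (1/2) * x powr (-\<eta>)"
      proof -
        have "x / real D \<le> x / (w / 2)" using D w1 x by (intro divide_left_mono) auto
        also have "\<dots> = 2 * real q * (y * y) / (y powr (1/2) * y * x powr \<eta>)"
          by (simp add: w_def yw) (simp add: xy power2_eq_square)
        also have "\<dots> = 2 * real q * (y / y powr (1/2)) * x powr (-\<eta>)"
        proof -
          have "2 * r * (y * y) / (s * y * m) = 2 * r * (y / s) * inverse m" for r s m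
            using y1 by (simp add: divide_simps)
          thus ?thesis by (simp only: powr_minus)
        qed
        also have "y / y powr (1/2) = y powr (1/2)" using y1 powr_diff[of y 1 "1/2"] by simp
        finally show ?thesis .
      qed
      have main: "real D / real q + x / (real q * real D) \<le> T / 2"
      proof -
        have "real D / real q \<le> w / real q" using D by (simp add: divide_right_mono)
        also have "\<dots> = y powr (1/2) * x powr \<eta> * (y / real q)" by (simp add: w_def yw)
        also have "\<dots> \<le> y powr (1/2) * x powr \<eta> * 1" using y_le_q q by (intro mult_left_mono) auto
        finally have 1: "real D / real q \<le> y powr (1/2) * x powr \<eta>" by simp
        have "x / (real q * real D) = x / real D / real q" by simp
        also have "\<dots> \<le> (2 * real q * y powr (1/2) * x powr (-\<eta>)) / real q"
          using xD by (intro divide_right_mono) auto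
        also have "\<dots> = 2 * (y powr (1/2) * x powr (-\<eta>))" using q by simp
        also have "\<dots> \<le> 2 * (y powr (1/2) * x powr \<eta>)"
          using x pos by (intro mult_left_mono powr_mono) auto
        finally have "real D / real q + x / (real q * real D) \<le> 3 * (y powr (1/2) * x powr \<eta>)" using 1 by linarith
        also have "\<dots> \<le> x powr (\<epsilon> - \<eta>) / 2 * (y powr (1/2) * x powr \<eta>)"
          using large by (intro mult_right_mono) auto
        also have "\<dots> = T / 2"
        proof -
          have "x powr \<epsilon> = x powr (\<epsilon> - \<eta>) * x powr \<eta>" by (simp flip: powr_add)
          thus ?thesis by (simp add: Tdef)
        qed
        finally show ?thesis .
      qed
      define g where "g = real (divisor_prod q)"
      have q_powr: "real q powr \<delta> \<le> x powr \<delta>" using qx q pos by (intro powr_mono2) auto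
      have g: "g \<le> C1 * x powr \<delta>"
        using C1(2)[OF q] mult_left_mono[OF q_powr, of C1] C1(1) unfolding g_def by linarith
      have \<tau>: "real (card {d. d dvd q}) \<le> C1 * x powr \<delta>"
        using of_nat_mono[OF card_divisors_le_divisor_prod[OF q], where 'a = real] g unfolding g_def by linarith
      have Hq: "harm q \<le> C2 * x powr \<delta>"
        using harm_le_powr[OF pos(2) q] mult_left_mono[OF q_powr, of C2] C23 unfolding C2_def by linarith
      have HD: "harm D \<le> C3 * x powr \<delta>"
      proof -
        have "y powr (3/2) \<le> y powr 2" using y1 by (intro powr_mono) auto
        also have "\<dots> = y\<^sup>2" using y1 powr_realpow[of y 2] by simp
        also have "\<dots> \<le> x" using y_sq_le qx by linarith
        finally have "w \<le> x * x powr \<eta>" unfolding w_def by (intro mult_right_mono) auto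
        also have "\<dots> = x powr (1 + \<eta>)" using x by (simp add: powr_add)
        finally have "real D \<le> x powr (1 + \<eta>)" using D by linarith
        hence "real D powr \<delta>' \<le> (x powr (1 + \<eta>)) powr \<delta>'" using pos by (intro powr_mono2) auto
        also have "\<dots> = x powr \<delta>" using pos by (simp add: powr_powr \<delta>'_def)
        finally have "C3 * real D powr \<delta>' \<le> C3 * x powr \<delta>" using C23 by (intro mult_left_mono) auto
        thus ?thesis using harm_le_powr[OF pos(3), of D] D unfolding C3_def by linarith
      qed
      \<comment> \<open>By \<open>y\<^sup>2 \<le> q\<close>, the lattice term
        \<open>D\<^sup>2 / q\<close> is at most \<open>y * x powr (2 * \<eta>)\<close>, so it is no
        worse than \<open>y\<close> up to a small power of \<open>x\<close>.\<close>
      have yD: "y + 2 * (real D)\<^sup>2 / real q \<le> 3 * y * x powr (2 * \<eta>)"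
      proof -
        have "(real D)\<^sup>2 \<le> w\<^sup>2" using D by (intro power_mono) auto
        also have "\<dots> \<le> real q * y * x powr (2 * \<eta>)"
          unfolding w_sq using y_sq_le y1 by (intro mult_right_mono) auto
        finally have "(real D)\<^sup>2 / real q \<le> y * x powr (2 * \<eta>)" using q by (simp add: divide_le_eq mult_ac)
        moreover have "y * 1 \<le> y * x powr (2 * \<eta>)"
          using y1 x pos by (intro mult_left_mono ge_one_powr_ge_zero) auto
        ultimately show ?thesis by simp
      qed
      define X where "X = x powr (3 * \<delta> + 2 * \<eta>)"
      have X3: "(x powr \<delta>) * (x powr \<delta>)\<^sup>2 * x powr (2 * \<eta>) = X" "(x powr \<delta>) ^ 3 \<le> X"
      proof -
        have "3 * \<delta> = \<delta> + 2 * \<delta>" by simp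
        hence cube: "(x powr \<delta>) * (x powr \<delta>)\<^sup>2 = x powr (3 * \<delta>)"
          by (simp only: powr_square powr_add)
        thus "(x powr \<delta>) * (x powr \<delta>)\<^sup>2 * x powr (2 * \<eta>) = X" by (simp add: X_def powr_add)
        have "(x powr \<delta>) ^ 3 = x powr (3 * \<delta>)" unfolding cube[symmetric] by (simp add: power3_eq_cube power2_eq_square)
        also have "\<dots> \<le> X" unfolding X_def using x pos by (intro powr_mono) auto
        finally show "(x powr \<delta>) ^ 3 \<le> X" .
      qed
      have V1: "16 * real (card {d. d dvd q}) * (harm q)\<^sup>2 * (y + 2 * (real D)\<^sup>2 / real q) \<le> 48 * C1 * C2\<^sup>2 * (y * X)"
      proof -
        have "16 * real (card {d. d dvd q}) * (harm q)\<^sup>2 * (y + 2 * (real D)\<^sup>2 / real q)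
            \<le> 16 * (C1 * x powr \<delta>) * (C2 * x powr \<delta>)\<^sup>2 * (3 * y * x powr (2 * \<eta>))"
          using \<tau> Hq yD y1 C1 C23 harm_nonneg[of q, where 'a = real]
          by (intro mult_mono power_mono) auto
        also have "\<dots> = 48 * C1 * C2\<^sup>2 * (y * ((x powr \<delta>) * (x powr \<delta>)\<^sup>2 * x powr (2 * \<eta>)))"
          by (simp add: power_mult_distrib)
        finally show ?thesis unfolding X3 .
      qed
      have V2: "y * (harm D) ^ 3 \<le> C3 ^ 3 * (y * X)"
      proof -
        have "(harm D) ^ 3 \<le> (C3 * x powr \<delta>) ^ 3"
          using HD harm_nonneg[of D, where 'a = real] by (intro power_mono) auto
        also have "\<dots> \<le> C3 ^ 3 * X" using X3(2) C23 by (simp add: power_mult_distrib)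
        finally have "y * (harm D) ^ 3 \<le> y * (C3 ^ 3 * X)" using y1 by (intro mult_left_mono) auto
        thus ?thesis by (simp add: mult_ac)
      qed
      have T_sq: "T\<^sup>2 = y * x powr (2 * \<epsilon>)"
      proof -
        have "(y powr (1/2))\<^sup>2 = y" using y1 by (simp add: powr_square)
        moreover have "(x powr \<epsilon>)\<^sup>2 = x powr (2 * \<epsilon>)" by (rule powr_square)
        ultimately show ?thesis by (simp add: Tdef power_mult_distrib)
      qed
      have "real (card Bad)
         \<le> 16 / T\<^sup>2 * (real q * (16 * real (card {d. d dvd q}) * (harm q)\<^sup>2 * (y + 2 * (real D)\<^sup>2 / real q) + y * (harm D) ^ 3))
           + 4 / T * (x / real D)"
        unfolding Bad_def by (rule card_sqfree_error_gt_le[OF q y1 xy D(1) T0 main])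
      also have "\<dots> \<le> 16 / T\<^sup>2 * (real q * (48 * C1 * C2\<^sup>2 * (y * X) + C3 ^ 3 * (y * X)))
           + 4 / T * (2 * real q * y powr (1/2) * x powr (-\<eta>))"
        using V1 V2 xD T0 by (intro add_mono mult_left_mono) auto
      also have "\<dots> = real q * (16 * (48 * C1 * C2\<^sup>2 + C3 ^ 3)) * (X / x powr (2 * \<epsilon>))
           + real q * 8 * (x powr (-\<eta>) / x powr \<epsilon>)"
      proof -
        have "16 / (y * u) * (r * (a * (y * v) + b * (y * v))) = r * (16 * (a + b)) * (v / u)" if "u > 0" for a b r u v
          using y1 that by (simp add: field_simps)
        moreover have "4 / (s * u) * (2 * r * s * v) = r * 8 * (v / u)" if "s > 0" "u > 0" for r s u v :: real
          using that by (simp add: field_simps)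
        ultimately show ?thesis unfolding T_sq unfolding Tdef using x y1 by simp
      qed
      also have "\<dots> \<le> real q * (16 * (48 * C1 * C2\<^sup>2 + C3 ^ 3)) * x powr (- \<epsilon> - \<delta>)
           + real q * 8 * x powr (- \<epsilon> - \<delta>)"
      proof (intro add_mono mult_left_mono)
        show "X / x powr (2 * \<epsilon>) \<le> x powr (- \<epsilon> - \<delta>)"
          unfolding X_def powr_diff[symmetric] using x assms by (intro powr_mono) (auto simp: \<delta>_def \<eta>_def)
        show "x powr (- \<eta>) / x powr \<epsilon> \<le> x powr (- \<epsilon> - \<delta>)"
          unfolding powr_diff[symmetric] using x assms by (intro powr_mono) (auto simp: \<delta>_def \<eta>_def)
      qed (use C1 C23 in auto)
      also have "\<dots> = real q * (K * x powr (- \<epsilon> - \<delta>))" by (simp add: K_def algebra_simps)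
      also have "\<dots> \<le> real (totient q) * (C1 * x powr \<delta>) * (K * x powr (- \<epsilon> - \<delta>))"
      proof (rule mult_right_mono)
        have "real q \<le> real (totient q) * g" unfolding g_def by (rule le_totient_mult_divisor_prod[OF q])
        also have "\<dots> \<le> real (totient q) * (C1 * x powr \<delta>)" by (intro mult_left_mono g) auto
        finally show "real q \<le> real (totient q) * (C1 * x powr \<delta>)" .
      qed (use K0 in auto)
      also have "\<dots> = real (totient q) * (C1 * K * (x powr \<delta> * x powr (- \<epsilon> - \<delta>)))" by (simp add: mult_ac)
      also have "x powr \<delta> * x powr (- \<epsilon> - \<delta>) = x powr (- \<epsilon>)" by (simp flip: powr_add)
      also have "real (totient q) * (C1 * K * x powr (- \<epsilon>)) \<le> real (totient q) * (C * x powr (- \<epsilon>))"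
        by (intro mult_left_mono mult_right_mono) (auto simp: C_def)
      finally show ?thesis using tot0 by (simp add: divide_le_eq mult.commute)
    qed
    thus "\<bar>1 / real (totient q) *
             real (card {a \<in> totatives q. \<bar>sqfree_error x q a\<bar> > (x / real q) powr (1/4) * x powr \<epsilon>})\<bar>
           \<le> C * x powr (-\<epsilon>)"
      unfolding Bad_def T_def by simp
  qed
qed

end
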